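(* For every positive integer $n$, the grammic monoid $\mathbb{G}_n$ of rank $n$ satisfies exactly the same semigroup identities as the monoid ${\rm UT}_n(\mathbb{T})$ of $n\times n$ upper triangular tropical matrices. In other words, the variety of semigroups generated by $\mathbb{G}_n$ is $\mathbf{V}_n$, the variety of semigroups generated by ${\rm UT}_n(\mathbb{T})$.
   Context: Grammic monoid: write $[n]=\{1<2<\cdots<n\}$, and $\mathbb{N}_0$ for the non-negative integers. Each letter $a\in[n]$ acts on $\mathbb{N}_0^n$ on the right: for $\gamma\in\mathbb{N}_0^n$ let $t=\min\{s\in[n]: s>a,\ \gamma_s>0\}$ if this set is non-empty; then $\gamma\cdot a=\gamma+e_a-e_t$ if $t$ is defined, and $\gamma\cdot a=\gamma+e_a$ otherwise, where $e_i$ is the $i$th standard basis vector. This extends to words by $\gamma\cdot\varepsilon=\gamma$ and $\gamma\cdot(w_1\cdots w_k)=(\cdots(\gamma\cdot w_1)\cdots)\cdot w_k$. For $u,v\in[n]^*$, $u\equiv_{\rm gram}v$ means $\gamma\cdot u=\gamma\cdot v$ for all $\gamma\in\mathbb{N}_0^n$; this is a congruence and $\mathbb{G}_n=[n]^*/\equiv_{\rm gram}$. Tropical matrices: $\mathbb{T}=\mathbb{R}\cup\{-\infty\}$ is a semiring under $a\oplus b=\max(a,b)$ and $a\otimes b=a+b$ (with $-\infty$ the zero element). ${\rm UT}_n(\mathbb{T})$ is the monoid of $n\times n$ matrices $A$ over $\mathbb{T}$ with $A_{i,j}=-\infty$ for $i>j$, under the induced matrix multiplication. Identities: a semigroup identity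 over an alphabet $\Sigma$ is a pair of words $u=v$ with $u,v\in\Sigma^+$ (the free semigroup); a semigroup $S$ satisfies it if every morphism $\Sigma^+\to S$ maps $u$ and $v$ to the same element. The variety generated by $S$ is the class of all semigroups satisfying all semigroup identities satisfied by $S$. *)

theory Defs
  imports "HOL-Algebra.Group" "Jordan_Normal_Form.Matrix"
begin

section \<open>The grammic monoid\<close>

text \<open>
  A vector of \<open>\<nat>\<^sub>0\<^sup>n\<close> is encoded as a function that vanishes outside the index set \<open>{1..n}\<close>.
\<close>

definition nat_vecs :: "nat \<Rightarrow> (nat \<Rightarrow> nat) set" where
  "nat_vecs n = {\<gamma>. \<forall>i. i \<notin> {1..n} \<longrightarrow> \<gamma> i = 0}"

definition act_letter :: "nat \<Rightarrow> (nat \<Rightarrow> nat) \<Rightarrow> nat \<Rightarrow> (nat \<Rightarrow> nat)" where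
  "act_letter n \<gamma> a =
     (let S = {s \<in> {1..n}. s > a \<and> \<gamma> s > 0} in
      if S = {} then \<gamma>(a := \<gamma> a + 1)
      else \<gamma>(a := \<gamma> a + 1, Min S := \<gamma> (Min S) - 1))"

definition act_word :: "nat \<Rightarrow> (nat \<Rightarrow> nat) \<Rightarrow> nat list \<Rightarrow> (nat \<Rightarrow> nat)" where
  "act_word n = foldl (act_letter n)"

definition gram_rel :: "nat \<Rightarrow> (nat list \<times> nat list) set" where
  "gram_rel n = {(u, v). u \<in> lists {1..n} \<and> v \<in> lists {1..n} \<and>
                         (\<forall>\<gamma> \<in> nat_vecs n. act_word n \<gamma> u = act_word n \<gamma> v)}"

definition grammic_monoid :: "nat \<Rightarrow> nat list set monoid" where
  "grammic_monoid n =
     \<lparr>carrier = lists {1..n} // gram_rel n,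
      mult = (\<lambda>X Y. \<Union>u\<in>X. \<Union>v\<in>Y. gram_rel n `` {u @ v}),
      one = gram_rel n `` {[]}\<rparr>"

lemma act_word_append: "act_word n \<gamma> (u @ v) = act_word n (act_word n \<gamma> u) v"
  by (simp add: act_word_def)

lemma act_letter_closed:
  assumes "\<gamma> \<in> nat_vecs n" "a \<in> {1..n}"
  shows "act_letter n \<gamma> a \<in> nat_vecs n"
  using assms by (auto simp: nat_vecs_def act_letter_def Let_def)

lemma act_word_closed:
  "\<lbrakk>\<gamma> \<in> nat_vecs n; u \<in> lists {1..n}\<rbrakk> \<Longrightarrow> act_word n \<gamma> u \<in> nat_vecs n"
proof (induction u arbitrary: \<gamma>)
  case Nil
  then show ?case by (simp add: act_word_def)
next
  case (Cons a u)
  then have "act_letter n \<gamma> a \<in> nat_vecs n" by (intro act_letter_closed) auto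
  with Cons show ?case by (simp add: act_word_def)
qed

lemma equiv_gram_rel: "equiv (lists {1..n}) (gram_rel n)"
  by (intro equivI) (auto simp: gram_rel_def refl_on_def sym_def trans_def)

lemma gram_rel_append:
  "\<lbrakk>(u, u') \<in> gram_rel n; (v, v') \<in> gram_rel n\<rbrakk> \<Longrightarrow> (u @ v, u' @ v') \<in> gram_rel n"
  by (auto simp: gram_rel_def act_word_append act_word_closed)

lemma grammic_mult_class:
  assumes "u \<in> lists {1..n}" "v \<in> lists {1..n}"
  shows "mult (grammic_monoid n) (gram_rel n `` {u}) (gram_rel n `` {v}) = gram_rel n `` {u @ v}"
proof -
  have "congruent2 (gram_rel n) (gram_rel n) (\<lambda>u v. gram_rel n `` {u @ v})"
    by (intro congruent2I') (blast intro!: equiv_class_eq[OF equiv_gram_rel] gram_rel_append)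
  from UN_equiv_class2[OF equiv_gram_rel equiv_gram_rel this assms]
  show ?thesis by (simp add: grammic_monoid_def)
qed

lemma grammic_carrierE:
  assumes "X \<in> carrier (grammic_monoid n)"
  obtains u where "u \<in> lists {1..n}" "X = gram_rel n `` {u}"
  using assms by (auto simp: grammic_monoid_def elim!: quotientE)

lemma grammic_carrierI:
  "u \<in> lists {1..n} \<Longrightarrow> gram_rel n `` {u} \<in> carrier (grammic_monoid n)"
  by (simp add: grammic_monoid_def quotientI)

lemma grammic_one: "one (grammic_monoid n) = gram_rel n `` {[]}"
  by (simp add: grammic_monoid_def)

lemma monoid_grammic_monoid: "Group.monoid (grammic_monoid n)"
proof (rule monoidI)
  fix X Y assume "X \<in> carrier (grammic_monoid n)" "Y \<in> carrier (grammic_monoid n)"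
  then show "mult (grammic_monoid n) X Y \<in> carrier (grammic_monoid n)"
    by (elim grammic_carrierE) (simp add: grammic_mult_class grammic_carrierI)
next
  show "one (grammic_monoid n) \<in> carrier (grammic_monoid n)"
    by (simp add: grammic_one grammic_carrierI)
next
  fix X Y Z
  assume "X \<in> carrier (grammic_monoid n)" "Y \<in> carrier (grammic_monoid n)"
    "Z \<in> carrier (grammic_monoid n)"
  then show "mult (grammic_monoid n) (mult (grammic_monoid n) X Y) Z =
             mult (grammic_monoid n) X (mult (grammic_monoid n) Y Z)"
    by (elim grammic_carrierE) (simp add: grammic_mult_class)
next
  fix X assume "X \<in> carrier (grammic_monoid n)"
  then show "mult (grammic_monoid n) (one (grammic_monoid n)) X = X"
    by (elim grammic_carrierE) (simp add: grammic_mult_class grammic_one)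
next
  fix X assume "X \<in> carrier (grammic_monoid n)"
  then show "mult (grammic_monoid n) X (one (grammic_monoid n)) = X"
    by (elim grammic_carrierE) (simp add: grammic_mult_class grammic_one)
qed

section \<open>Upper triangular tropical matrices\<close>

datatype trop = MInfty | Fin real

text \<open>
  The class operations \<open>+\<close>, \<open>*\<close>, \<open>0\<close>, \<open>1\<close> are the tropical ones (maximum, addition, \<open>-\<infinity>\<close> and the
  real number 0), so that matrix multiplication and triangularity from the matrix library are the
  tropical notions.
\<close>

instantiation trop :: comm_semiring_1
begin

fun plus_trop :: "trop \<Rightarrow> trop \<Rightarrow> trop" where
  "MInfty + b = b"
| "Fin x + MInfty = Fin x"
| "Fin x + Fin y = Fin (max x y)"

fun times_trop :: "trop \<Rightarrow> trop \<Rightarrow> trop" where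
  "MInfty * b = MInfty"
| "Fin x * MInfty = MInfty"
| "Fin x * Fin y = Fin (x + y)"

definition zero_trop :: trop where "0 = MInfty"

definition one_trop :: trop where "1 = Fin 0"

instance
proof
  fix a b c :: trop
  show "a + b + c = a + (b + c)" by (cases a; cases b; cases c) auto
  show "a + b = b + a" by (cases a; cases b) auto
  show "0 + a = a" by (simp add: zero_trop_def)
  show "a * b * c = a * (b * c)" by (cases a; cases b; cases c) auto
  show "a * b = b * a" by (cases a; cases b) auto
  show "1 * a = a" by (cases a) (auto simp: one_trop_def)
  show "(a + b) * c = a * c + b * c" by (cases a; cases b; cases c) auto
  show "0 * a = 0" by (simp add: zero_trop_def)
  show "a * 0 = 0" by (cases a) (auto simp: zero_trop_def)
  show "(0::trop) \<noteq> 1" by (simp add: zero_trop_def one_trop_def)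
qed

end

definition UT_trop :: "nat \<Rightarrow> trop mat monoid" where
  "UT_trop n =
     \<lparr>carrier = {A \<in> carrier_mat n n. upper_triangular A}, mult = (*), one = 1\<^sub>m n\<rparr>"

lemma upper_triangular_mult_trop:
  fixes A B :: "trop mat"
  assumes "A \<in> carrier_mat n n" "B \<in> carrier_mat n n" "upper_triangular A" "upper_triangular B"
  shows "upper_triangular (A * B)"
proof (rule upper_triangularI)
  fix i j assume ji: "j < i" and "i < dim_row (A * B)"
  then have i: "i < n" using assms by simp
  have "A $$ (i, k) * B $$ (k, j) = 0" if "k < n" for k
  proof (cases "k < i")
    case True
    then have "A $$ (i, k) = 0" using assms i by (intro upper_triangularD) auto
    then show ?thesis by simp
  next
    case False
    then have "B $$ (k, j) = 0" using assms ji that by (intro upper_triangularD) auto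
    then show ?thesis by simp
  qed
  then show "(A * B) $$ (i, j) = 0"
    using assms i ji by (simp add: scalar_prod_def)
qed

lemma monoid_UT_trop: "Group.monoid (UT_trop n)"
  by (rule monoidI) (auto simp: UT_trop_def upper_triangular_mult_trop)

section \<open>Semigroups, identities and varieties\<close>

record 'a sgrp = "'a partial_object" +
  sg_mult :: "'a \<Rightarrow> 'a \<Rightarrow> 'a"

definition is_sgrp :: "'a sgrp \<Rightarrow> bool" where
  "is_sgrp S \<longleftrightarrow>
     (\<forall>x\<in>carrier S. \<forall>y\<in>carrier S. sg_mult S x y \<in> carrier S) \<and>
     (\<forall>x\<in>carrier S. \<forall>y\<in>carrier S. \<forall>z\<in>carrier S.
        sg_mult S (sg_mult S x y) z = sg_mult S x (sg_mult S y z))"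

definition sgrp_hom :: "'a sgrp \<Rightarrow> 'b sgrp \<Rightarrow> ('a \<Rightarrow> 'b) set" where
  "sgrp_hom S T = {h. h \<in> carrier S \<rightarrow> carrier T \<and>
     (\<forall>x\<in>carrier S. \<forall>y\<in>carrier S. h (sg_mult S x y) = sg_mult T (h x) (h y))}"

definition sgrp_of_monoid :: "'a monoid \<Rightarrow> 'a sgrp" where
  "sgrp_of_monoid M = \<lparr>carrier = carrier M, sg_mult = mult M\<rparr>"

definition free_sgrp :: "'x set \<Rightarrow> 'x list sgrp" where
  "free_sgrp \<Sigma> = \<lparr>carrier = lists \<Sigma> - {[]}, sg_mult = (@)\<rparr>"

definition satisfies_identity :: "'x set \<Rightarrow> 'a sgrp \<Rightarrow> 'x list \<times> 'x list \<Rightarrow> bool" where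
  "satisfies_identity \<Sigma> S p \<longleftrightarrow> (\<forall>h \<in> sgrp_hom (free_sgrp \<Sigma>) S. h (fst p) = h (snd p))"

definition identities :: "'x set \<Rightarrow> 'a sgrp \<Rightarrow> ('x list \<times> 'x list) set" where
  "identities \<Sigma> S =
     {p \<in> carrier (free_sgrp \<Sigma>) \<times> carrier (free_sgrp \<Sigma>). satisfies_identity \<Sigma> S p}"

text \<open>
  A class of semigroups is represented by its members on an arbitrary carrier type \<open>'b\<close>.  An
  identity involves only finitely many letters, so up to renaming it is an identity over
  an alphabet of natural numbers; these are the alphabets quantified over here.
\<close>

definition variety_generated_by :: "'a sgrp \<Rightarrow> 'b sgrp set" where
  "variety_generated_by S =
     {T. is_sgrp T \<and> (\<forall>\<Sigma> :: nat set. \<forall>p \<in> identities \<Sigma> S. satisfies_identity \<Sigma> T p)}"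

lemma is_sgrp_of_monoid: "Group.monoid M \<Longrightarrow> is_sgrp (sgrp_of_monoid M)"
  by (simp add: is_sgrp_def sgrp_of_monoid_def monoid.m_closed monoid.m_assoc)

lemma is_sgrp_free_sgrp: "is_sgrp (free_sgrp \<Sigma>)"
  by (simp add: is_sgrp_def free_sgrp_def)

end

theory Submission
  imports Defs
begin

text \<open>
  On prefix sums \<open>F q = \<gamma> 1 + \<dots> + \<gamma> q\<close> a letter \<open>a\<close> acts by \<open>F q \<mapsto> max (F q) (F a + 1)\<close> for
  \<open>q \<ge> a\<close>, which is multiplication by an upper triangular tropical matrix.  So the grammic monoid
  embeds into \<open>UT_trop n\<close> and satisfies all of its identities.

  Conversely, let the \<open>(p, q)\<close> entry of the value of \<open>u\<close> exceed that of \<open>v\<close>, and take an optimal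
  path for \<open>u\<close>: it visits states \<open>t 0 < \<dots> < t k\<close>, moves from \<open>t i\<close> to \<open>t (i + 1)\<close> on a letter
  \<open>w i\<close>, and reads all remaining letters on loops.  The loop weights are scaled and rounded to
  integers \<open>d x i\<close>.  Each letter \<open>x\<close> is then replaced by a word over \<open>[k + 1]\<close> acting on the prefix
  sums as a tropical matrix with diagonal \<open>lam + d x i\<close> and with a bonus \<open>lam + mu\<close> for the steps
  \<open>i \<rightarrow> i + 1\<close> with \<open>x = w i\<close>; here \<open>mu\<close> dwarfs the loop weights and \<open>lam\<close> dwarfs \<open>mu\<close>.  Collecting
  all \<open>k\<close> bonuses requires an occurrence of \<open>w\<close> as a scattered subword, and among those the
  remaining weight is compared as in the original matrices.
\<close>

section \<open>Evaluating words in a monoid\<close>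

definition eval_word :: "('a, 'c) monoid_scheme \<Rightarrow> ('x \<Rightarrow> 'a) \<Rightarrow> 'x list \<Rightarrow> 'a" where
  "eval_word M f u = foldr (\<lambda>x y. f x \<otimes>\<^bsub>M\<^esub> y) u \<one>\<^bsub>M\<^esub>"

lemma eval_word_simps [simp]:
  "eval_word M f [] = \<one>\<^bsub>M\<^esub>"
  "eval_word M f (x # u) = f x \<otimes>\<^bsub>M\<^esub> eval_word M f u"
  by (simp_all add: eval_word_def)

lemma eval_word_closed:
  assumes "Group.monoid M" "f ` set u \<subseteq> carrier M"
  shows "eval_word M f u \<in> carrier M"
  using assms(2)
  by (induction u) (auto intro: monoid.m_closed[OF assms(1)] monoid.one_closed[OF assms(1)])

lemma eval_word_append:
  assumes "Group.monoid M" "f ` set u \<subseteq> carrier M" "f ` set v \<subseteq> carrier M"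
  shows "eval_word M f (u @ v) = eval_word M f u \<otimes>\<^bsub>M\<^esub> eval_word M f v"
  using assms(2,3)
proof (induction u)
  case Nil
  then show ?case
    by (simp add: monoid.l_one[OF assms(1)] eval_word_closed[OF assms(1)])
next
  case (Cons x u)
  then show ?case
    by (simp add: monoid.m_assoc[OF assms(1)] eval_word_closed[OF assms(1)])
qed

lemma eval_word_snoc:
  assumes "Group.monoid M" "f ` set u \<subseteq> carrier M" "f x \<in> carrier M"
  shows "eval_word M f (u @ [x]) = eval_word M f u \<otimes>\<^bsub>M\<^esub> f x"
  using assms by (simp add: eval_word_append monoid.r_one)

text \<open>A morphism from a free semigroup is determined by its values on one-letter words, and
  any choice of these values extends to a morphism.\<close>

lemma satisfies_identity_monoid_iff:
  assumes M: "Group.monoid M" and uv: "(u, v) \<in> carrier (free_sgrp \<Sigma>) \<times> carrier (free_sgrp \<Sigma>)"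
  shows "satisfies_identity \<Sigma> (sgrp_of_monoid M) (u, v) \<longleftrightarrow>
         (\<forall>f. f ` \<Sigma> \<subseteq> carrier M \<longrightarrow> eval_word M f u = eval_word M f v)"
proof
  assume sat: "satisfies_identity \<Sigma> (sgrp_of_monoid M) (u, v)"
  show "\<forall>f. f ` \<Sigma> \<subseteq> carrier M \<longrightarrow> eval_word M f u = eval_word M f v"
  proof (intro allI impI)
    fix f assume f: "f ` \<Sigma> \<subseteq> carrier M"
    have "f ` set z \<subseteq> carrier M" if "z \<in> lists \<Sigma>" for z
      using f that by auto
    then have "eval_word M f \<in> sgrp_hom (free_sgrp \<Sigma>) (sgrp_of_monoid M)"
      by (auto simp: sgrp_hom_def free_sgrp_def sgrp_of_monoid_def
          intro!: eval_word_closed[OF M] eval_word_append[OF M])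
    with sat show "eval_word M f u = eval_word M f v"
      by (auto simp: satisfies_identity_def)
  qed
next
  assume ev: "\<forall>f. f ` \<Sigma> \<subseteq> carrier M \<longrightarrow> eval_word M f u = eval_word M f v"
  show "satisfies_identity \<Sigma> (sgrp_of_monoid M) (u, v)"
    unfolding satisfies_identity_def
  proof
    fix h assume h: "h \<in> sgrp_hom (free_sgrp \<Sigma>) (sgrp_of_monoid M)"
    have closed: "h [x] \<in> carrier M" if "x \<in> \<Sigma>" for x
      using h that by (auto simp: sgrp_hom_def free_sgrp_def sgrp_of_monoid_def)
    have mult: "h (y @ z) = h y \<otimes>\<^bsub>M\<^esub> h z"
      if "y \<in> lists \<Sigma>" "z \<in> lists \<Sigma>" "y \<noteq> []" "z \<noteq> []" for y z
      using h that by (auto simp: sgrp_hom_def free_sgrp_def sgrp_of_monoid_def)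
    have eq: "h z = eval_word M (\<lambda>x. h [x]) z" if "z \<noteq> []" "z \<in> lists \<Sigma>" for z
      using that
    proof (induction z rule: list_nonempty_induct)
      case (single x)
      then show ?case by (simp add: monoid.r_one[OF M] closed)
    next
      case (cons x xs)
      then show ?case using mult[of "[x]" xs] by simp
    qed
    have "(\<lambda>x. h [x]) ` \<Sigma> \<subseteq> carrier M" using closed by blast
    with ev have "eval_word M (\<lambda>x. h [x]) u = eval_word M (\<lambda>x. h [x]) v" by blast
    then show "h (fst (u, v)) = h (snd (u, v))"
      using uv eq[of u] eq[of v] by (simp add: free_sgrp_def del: in_lists_conv_set)
  qed
qed

section \<open>Identities of the grammic monoid as statements about substitutions\<close>

lemma gram_class_eq_iff:
  assumes "u \<in> lists {1..n}" "v \<in> lists {1..n}"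
  shows "gram_rel n `` {u} = gram_rel n `` {v} \<longleftrightarrow>
         (\<forall>\<gamma>\<in>nat_vecs n. act_word n \<gamma> u = act_word n \<gamma> v)"
  using eq_equiv_class_iff[OF equiv_gram_rel assms] assms by (simp add: gram_rel_def)

lemma eval_word_grammic:
  assumes "\<phi> ` set u \<subseteq> lists {1..n}"
  shows "eval_word (grammic_monoid n) (\<lambda>x. gram_rel n `` {\<phi> x}) u =
         gram_rel n `` {concat (map \<phi> u)}"
  using assms
proof (induction u)
  case Nil
  then show ?case by (simp add: grammic_one)
next
  case (Cons x u)
  then have "concat (map \<phi> u) \<in> lists {1..n}" by fastforce
  with Cons show ?case by (simp add: grammic_mult_class)
qed

text \<open>Choosing a representative word in each class turns assignments of classes into
  substitutions \<open>\<phi>\<close> of words.\<close>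

lemma satisfies_identity_grammic_iff:
  assumes uv: "(u, v) \<in> carrier (free_sgrp \<Sigma>) \<times> carrier (free_sgrp \<Sigma>)"
  shows "satisfies_identity \<Sigma> (sgrp_of_monoid (grammic_monoid n)) (u, v) \<longleftrightarrow>
         (\<forall>\<phi>. \<phi> ` \<Sigma> \<subseteq> lists {1..n} \<longrightarrow>
           (\<forall>\<gamma>\<in>nat_vecs n. act_word n \<gamma> (concat (map \<phi> u)) = act_word n \<gamma> (concat (map \<phi> v))))"
    (is "?L \<longleftrightarrow> ?R")
proof -
  have cc: "concat (map \<phi> z) \<in> lists {1..n}" "\<phi> ` set z \<subseteq> lists {1..n}"
    if "\<phi> ` \<Sigma> \<subseteq> lists {1..n}" "z \<in> lists \<Sigma>" for \<phi> z
    using that by fastforce+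
  have uv': "u \<in> lists \<Sigma>" "v \<in> lists \<Sigma>" using uv by (auto simp: free_sgrp_def)
  have cls: "eval_word (grammic_monoid n) (\<lambda>x. gram_rel n `` {\<phi> x}) u =
        eval_word (grammic_monoid n) (\<lambda>x. gram_rel n `` {\<phi> x}) v \<longleftrightarrow>
      (\<forall>\<gamma>\<in>nat_vecs n. act_word n \<gamma> (concat (map \<phi> u)) = act_word n \<gamma> (concat (map \<phi> v)))"
    if "\<phi> ` \<Sigma> \<subseteq> lists {1..n}" for \<phi>
    unfolding eval_word_grammic[OF cc(2)[OF that uv'(1)]] eval_word_grammic[OF cc(2)[OF that uv'(2)]]
    by (rule gram_class_eq_iff[OF cc(1)[OF that uv'(1)] cc(1)[OF that uv'(2)]])
  show ?thesis
    unfolding satisfies_identity_monoid_iff[OF monoid_grammic_monoid uv]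
  proof (intro iffI allI impI)
    fix \<phi> assume *: "\<forall>f. f ` \<Sigma> \<subseteq> carrier (grammic_monoid n) \<longrightarrow>
      eval_word (grammic_monoid n) f u = eval_word (grammic_monoid n) f v"
      and \<phi>: "\<phi> ` \<Sigma> \<subseteq> lists {1..n}"
    have "(\<lambda>x. gram_rel n `` {\<phi> x}) ` \<Sigma> \<subseteq> carrier (grammic_monoid n)"
      using \<phi> by (auto intro!: grammic_carrierI simp del: in_lists_conv_set)
    with * cls[OF \<phi>]
    show "\<forall>\<gamma>\<in>nat_vecs n. act_word n \<gamma> (concat (map \<phi> u)) = act_word n \<gamma> (concat (map \<phi> v))"
      by blast
  next
    fix f assume R: ?R and f: "f ` \<Sigma> \<subseteq> carrier (grammic_monoid n)"
    have "\<forall>x\<in>\<Sigma>. \<exists>w. w \<in> lists {1..n} \<and> f x = gram_rel n `` {w}"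
      using f by (metis grammic_carrierE image_subset_iff)
    then obtain \<phi> where \<phi>: "\<forall>x\<in>\<Sigma>. \<phi> x \<in> lists {1..n} \<and> f x = gram_rel n `` {\<phi> x}"
      by metis
    have "eval_word (grammic_monoid n) f z =
        eval_word (grammic_monoid n) (\<lambda>x. gram_rel n `` {\<phi> x}) z" if "z \<in> lists \<Sigma>" for z
      using that \<phi> by (induction z) auto
    moreover have "\<phi> ` \<Sigma> \<subseteq> lists {1..n}" using \<phi> by blast
    ultimately show "eval_word (grammic_monoid n) f u = eval_word (grammic_monoid n) f v"
      using R cls[of \<phi>] uv' by (simp del: in_lists_conv_set)
  qed
qed

section \<open>The grammic action on prefix sums\<close>

definition prefix_sum :: "(nat \<Rightarrow> nat) \<Rightarrow> nat \<Rightarrow> nat" where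
  "prefix_sum \<gamma> q = (\<Sum>s\<le>q. \<gamma> s)"

definition lift :: "(nat \<Rightarrow> nat) \<Rightarrow> nat \<Rightarrow> nat \<Rightarrow> nat" where
  "lift F a q = (if a \<le> q then max (F q) (F a + 1) else F q)"

lemma mono_prefix_sum: "mono (prefix_sum \<gamma>)"
  by (auto simp: mono_def prefix_sum_def intro!: sum_mono2)

lemma nat_vecs_eqI:
  assumes "\<gamma> \<in> nat_vecs n" "\<delta> \<in> nat_vecs n"
    and eq: "\<And>q. q < n \<Longrightarrow> prefix_sum \<gamma> (Suc q) = prefix_sum \<delta> (Suc q)"
  shows "\<gamma> = \<delta>"
proof
  fix q
  have eq': "prefix_sum \<gamma> r = prefix_sum \<delta> r" if "r \<le> n" for r
    using assms that by (cases r) (simp_all add: nat_vecs_def prefix_sum_def)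
  show "\<gamma> q = \<delta> q"
  proof (cases "q \<in> {1..n}")
    case True
    then show ?thesis
      using eq'[of q] eq'[of "q - 1"] by (cases q) (simp_all add: prefix_sum_def)
  next
    case False
    then show ?thesis using assms(1,2) by (simp add: nat_vecs_def)
  qed
qed

text \<open>Additive on both sides, so that lowering an entry involves no truncated
  subtraction.\<close>

lemma prefix_sum_update:
  "prefix_sum (\<gamma>(a := y)) q + (if a \<le> q then \<gamma> a else 0) =
   prefix_sum \<gamma> q + (if a \<le> q then y else 0)"
proof (cases "a \<le> q")
  case True
  then have "prefix_sum \<delta> q = \<delta> a + sum \<delta> ({..q} - {a})" for \<delta>
    by (simp add: prefix_sum_def sum.remove)
  from this[of \<gamma>] this[of "\<gamma>(a := y)"] show ?thesis using True by simp
next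
  case False
  then show ?thesis by (auto simp: prefix_sum_def intro!: sum.cong)
qed

text \<open>From \<open>a\<close> up to just before the first positive entry \<open>t\<close> beyond
  it, the prefix sums all equal the one at \<open>a\<close> and grow by 1. From \<open>t\<close> on
  the two changes cancel, and the prefix sum already exceeds the one at \<open>a\<close>.\<close>

lemma prefix_sum_act_letter:
  assumes \<gamma>: "\<gamma> \<in> nat_vecs n" and a: "a \<in> {1..n}"
  shows "prefix_sum (act_letter n \<gamma> a) = lift (prefix_sum \<gamma>) a"
proof
  fix q
  define S where "S = {s \<in> {1..n}. s > a \<and> \<gamma> s > 0}"
  have flat: "prefix_sum \<gamma> q = prefix_sum \<gamma> a" if q: "a \<le> q" "\<forall>s\<in>S. q < s" for q
  proof -
    have "\<forall>s\<in>{..q} - {..a}. \<gamma> s = 0"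
    proof
      fix s assume s: "s \<in> {..q} - {..a}"
      then have "s \<notin> S" using q(2) by auto
      moreover have "s \<notin> {1..n} \<Longrightarrow> \<gamma> s = 0" using \<gamma> by (simp add: nat_vecs_def)
      ultimately show "\<gamma> s = 0" using s by (auto simp: S_def)
    qed
    then show ?thesis
      unfolding prefix_sum_def using q(1) by (intro sum.mono_neutral_right) auto
  qed
  show "prefix_sum (act_letter n \<gamma> a) q = lift (prefix_sum \<gamma>) a q"
  proof (cases "S = {}")
    case True
    then have "act_letter n \<gamma> a = \<gamma>(a := \<gamma> a + 1)"
      by (simp add: act_letter_def S_def Let_def)
    then show ?thesis
      using prefix_sum_update[of \<gamma> a "\<gamma> a + 1" q] flat[of q] True
      by (cases "a \<le> q") (simp_all add: lift_def)
  next
    case False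
    define t where "t = Min S"
    have "finite S" by (auto simp: S_def)
    then have "t \<in> S" and tmin: "\<And>s. s \<in> S \<Longrightarrow> t \<le> s"
      using False by (auto simp: t_def)
    then have t: "a < t" "\<gamma> t > 0" by (auto simp: S_def)
    have act: "act_letter n \<gamma> a = (\<gamma>(a := \<gamma> a + 1))(t := \<gamma> t - 1)"
      unfolding act_letter_def S_def[symmetric] Let_def t_def using False by simp
    have less: "prefix_sum \<gamma> a < prefix_sum \<gamma> q" if "t \<le> q" for q
    proof -
      have "prefix_sum \<gamma> a < prefix_sum \<gamma> t"
        unfolding prefix_sum_def using t by (intro sum_strict_mono2[of _ _ t]) auto
      also have "\<dots> \<le> prefix_sum \<gamma> q" using mono_prefix_sum that by (auto dest: monoD)
      finally show ?thesis .
    qed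
    note upd = prefix_sum_update[of \<gamma> a "\<gamma> a + 1" q]
      prefix_sum_update[of "\<gamma>(a := \<gamma> a + 1)" t "\<gamma> t - 1" q]
    consider "q < a" | "a \<le> q" "q < t" | "t \<le> q" by linarith
    then show ?thesis
    proof cases
      case 1
      then show ?thesis using upd t by (simp add: act lift_def)
    next
      case 2
      then have "prefix_sum \<gamma> q = prefix_sum \<gamma> a" using tmin by (intro flat) (auto intro: less_le_trans)
      then show ?thesis using upd t 2 by (simp add: act lift_def)
    next
      case 3
      then show ?thesis using upd t less[OF 3] by (simp add: act lift_def)
    qed
  qed
qed

lemma prefix_sum_act_word:
  assumes "\<gamma> \<in> nat_vecs n" "u \<in> lists {1..n}"
  shows "prefix_sum (act_word n \<gamma> u) = foldl lift (prefix_sum \<gamma>) u"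
  using assms
proof (induction u arbitrary: \<gamma>)
  case Nil
  then show ?case by (simp add: act_word_def)
next
  case (Cons a u)
  then have "act_letter n \<gamma> a \<in> nat_vecs n" by (intro act_letter_closed) auto
  with Cons show ?case by (simp add: act_word_def prefix_sum_act_letter)
qed

lemma mono_lift:
  assumes "mono F"
  shows "mono (lift F a)"
proof (rule monoI)
  fix p q :: nat assume "p \<le> q"
  then show "lift F a p \<le> lift F a q"
    using monoD[OF assms, of p q] by (auto simp: lift_def)
qed

lemma mono_foldl_lift: "mono F \<Longrightarrow> mono (foldl lift F u)"
  by (induction u arbitrary: F) (auto intro: mono_lift)

text \<open>Monotonicity makes the formula correct for \<open>c = 0\<close>, where
  \<open>max (F q) (F a)\<close> has to be \<open>F q\<close>.\<close>

lemma foldl_lift_replicate: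
  assumes "mono F"
  shows "foldl lift F (replicate c a) q = (if a \<le> q then max (F q) (F a + c) else F q)"
  using assms
proof (induction c arbitrary: F)
  case 0
  then show ?case by (auto simp: mono_def)
next
  case (Suc c)
  then show ?case
    using lift_def[of F a q] lift_def[of F a a] by (auto simp: mono_lift)
qed


section \<open>Words realising prescribed tropical matrices\<close>

text \<open>Letter \<open>Suc i\<close> raises level \<open>i\<close>. That level meets its
  \<open>c i\<close> block first and its \<open>e i\<close> block later; right after the
  \<open>c i\<close> block comes the \<open>e (i + 1)\<close> block, for which a path can climb.
  After that only blocks of levels up to \<open>i\<close> follow.\<close>

fun ladder :: "(nat \<Rightarrow> nat) \<Rightarrow> (nat \<Rightarrow> nat) \<Rightarrow> nat \<Rightarrow> nat list" where
  "ladder c e 0 = replicate (e 0) (Suc 0)"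
| "ladder c e (Suc k) =
     replicate (c k) (Suc k) @ replicate (e (Suc k)) (Suc (Suc k)) @ ladder c e k"

lemma ladder_in_lists: "ladder c e k \<in> lists {1..Suc k}"
  by (induction k) (auto simp: in_lists_conv_set)

lemma ladder_Suc_blocks:
  fixes F :: "nat \<Rightarrow> nat" and c e k q s :: nat
  assumes F: "mono F"
  defines "F' \<equiv> foldl lift (foldl lift F (replicate c (Suc k))) (replicate e (Suc (Suc k)))"
  shows "mono F'"
    and "s < k \<Longrightarrow> F' (Suc s) = F (Suc s)"
    and "F' (Suc k) = F (Suc k) + c"
    and "F' (Suc (Suc k)) = max (F (Suc (Suc k))) (F (Suc k) + c) + e"
    and "q > Suc k \<Longrightarrow> F' (Suc q) = max (F (Suc q)) (F' (Suc (Suc k)))"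
proof -
  have F1: "mono (foldl lift F (replicate c (Suc k)))" by (rule mono_foldl_lift[OF F])
  show "mono F'" unfolding F'_def by (rule mono_foldl_lift[OF F1])
  show "s < k \<Longrightarrow> F' (Suc s) = F (Suc s)"
    and "F' (Suc k) = F (Suc k) + c"
    and "F' (Suc (Suc k)) = max (F (Suc (Suc k))) (F (Suc k) + c) + e"
    and "q > Suc k \<Longrightarrow> F' (Suc q) = max (F (Suc q)) (F' (Suc (Suc k)))"
    using monoD[OF F, of "Suc (Suc k)" "Suc q"]
    by (auto simp: F'_def foldl_lift_replicate F F1)
qed

text \<open>No letter exceeds \<open>Suc k\<close>, so every raise that reaches level
  \<open>q\<close> reaches level \<open>k\<close> with the same value, and level \<open>k\<close>
  starts no higher.\<close>

lemma ladder_above: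
  assumes "mono F" "k < q"
  shows "foldl lift F (ladder c e k) (Suc q) =
         max (F (Suc q)) (foldl lift F (ladder c e k) (Suc k))"
  using assms
proof (induction k arbitrary: F q)
  case 0
  then show ?case
    using monoD[OF 0(1), of 1 "Suc q"] by (simp add: foldl_lift_replicate)
next
  case (Suc k)
  define F' where
    "F' = foldl lift (foldl lift F (replicate (c k) (Suc k))) (replicate (e (Suc k)) (Suc (Suc k)))"
  note F' = ladder_Suc_blocks[OF Suc.prems(1), where c = "c k" and k = k and e = "e (Suc k)",
      folded F'_def]
  have "foldl lift F (ladder c e (Suc k)) = foldl lift F' (ladder c e k)"
    by (simp add: F'_def)
  then show ?case
    using Suc.IH[OF F'(1), of q] Suc.IH[OF F'(1), of "Suc k"] F'(5)[of q] Suc.prems(2)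
    by simp
qed

text \<open>The path that waits at level \<open>r\<close> through its own blocks. The top level has
  no \<open>c\<close> block.\<close>

lemma ladder_stay:
  assumes "mono F" "r \<le> k"
  shows "F (Suc r) + (if r < k then c r else 0) + e r \<le> foldl lift F (ladder c e k) (Suc r)"
  using assms
proof (induction k arbitrary: F)
  case 0
  then show ?case by (simp add: foldl_lift_replicate)
next
  case (Suc k)
  define F' where
    "F' = foldl lift (foldl lift F (replicate (c k) (Suc k))) (replicate (e (Suc k)) (Suc (Suc k)))"
  note F' = ladder_Suc_blocks[OF Suc.prems(1), where c = "c k" and k = k and e = "e (Suc k)",
      folded F'_def]
  have eq: "foldl lift F (ladder c e (Suc k)) = foldl lift F' (ladder c e k)"
    by (simp add: F'_def)
  consider "r < k" | "r = k" | "r = Suc k" using Suc.prems(2) by linarith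
  then show ?case
  proof cases
    case 1
    then show ?thesis unfolding eq using Suc.IH[OF F'(1)] F'(2)[of r] by simp
  next
    case 2
    then show ?thesis unfolding eq using Suc.IH[OF F'(1)] F'(3) by simp
  next
    case 3
    then show ?thesis unfolding eq using ladder_above[OF F'(1), of k "Suc k" c e] F'(4) by simp
  qed
qed

text \<open>The path that waits through the \<open>c\<close> block of level \<open>r\<close> and
  climbs for the \<open>e\<close> block of the next level.\<close>

lemma ladder_jump:
  assumes "mono F" "r < k"
  shows "F (Suc r) + c r + e (Suc r) \<le> foldl lift F (ladder c e k) (Suc (Suc r))"
  using assms
proof (induction k arbitrary: F)
  case (Suc k)
  define F' where
    "F' = foldl lift (foldl lift F (replicate (c k) (Suc k))) (replicate (e (Suc k)) (Suc (Suc k)))"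
  note F' = ladder_Suc_blocks[OF Suc.prems(1), where c = "c k" and k = k and e = "e (Suc k)",
      folded F'_def]
  have eq: "foldl lift F (ladder c e (Suc k)) = foldl lift F' (ladder c e k)"
    by (simp add: F'_def)
  consider "r < k" | "r = k" using Suc.prems(2) by linarith
  then show ?case
  proof cases
    case 1
    then show ?thesis unfolding eq using Suc.IH[OF F'(1)] F'(2)[of r] by simp
  next
    case 2
    then show ?thesis unfolding eq using ladder_above[OF F'(1), of k "Suc k" c e] F'(4) by simp
  qed
qed simp

text \<open>After the one stay or climb only blocks of lower levels follow, so passing on to level
  \<open>q\<close> gains nothing; an early climb is absorbed by the monotonicity of
  \<open>F\<close>.\<close>

lemma ladder_cases:
  assumes "mono F" "q \<le> k"
  obtains (stay) r where "r \<le> q"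
      "foldl lift F (ladder c e k) (Suc q) = F (Suc r) + (if r < k then c r else 0) + e r"
    | (jump) r where "r < q"
      "foldl lift F (ladder c e k) (Suc q) = F (Suc r) + c r + e (Suc r)"
proof -
  have "(\<exists>r\<le>q. foldl lift F (ladder c e k) (Suc q) = F (Suc r) + (if r < k then c r else 0) + e r) \<or>
    (\<exists>r<q. foldl lift F (ladder c e k) (Suc q) = F (Suc r) + c r + e (Suc r))"
    using assms
  proof (induction k arbitrary: F q)
    case 0
    then show ?case by (simp add: foldl_lift_replicate)
  next
    case (Suc k)
    define F' where
      "F' = foldl lift (foldl lift F (replicate (c k) (Suc k))) (replicate (e (Suc k)) (Suc (Suc k)))"
    note F' = ladder_Suc_blocks[OF Suc.prems(1), where c = "c k" and k = k and e = "e (Suc k)",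
        folded F'_def]
    define R where "R = foldl lift F' (ladder c e k)"
    have eq: "foldl lift F (ladder c e (Suc k)) = R"
      by (simp add: F'_def R_def)
    have low: "(\<exists>r\<le>q. R (Suc q) = F (Suc r) + (if r < Suc k then c r else 0) + e r) \<or>
        (\<exists>r<q. R (Suc q) = F (Suc r) + c r + e (Suc r))" if q: "q \<le> k" for q
      using Suc.IH[OF F'(1) q, folded R_def]
    proof (elim disjE exE conjE)
      fix r assume r: "r \<le> q" "R (Suc q) = F' (Suc r) + (if r < k then c r else 0) + e r"
      then have "R (Suc q) = F (Suc r) + (if r < Suc k then c r else 0) + e r"
        using F'(2)[of r] F'(3) q by (cases "r < k") (simp_all add: le_less)
      with r(1) show ?thesis by blast
    next
      fix r assume r: "r < q" "R (Suc q) = F' (Suc r) + c r + e (Suc r)"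
      then have "R (Suc q) = F (Suc r) + c r + e (Suc r)"
        using F'(2)[of r] q by simp
      with r(1) show ?thesis by blast
    qed
    show ?case
    proof (cases "q \<le> k")
      case True
      then show ?thesis unfolding eq by (rule low)
    next
      case False
      then have q: "q = Suc k" using Suc.prems(2) by simp
      \<comment> \<open>The top level keeps its value from the two new blocks or takes over that of
        level \<open>k\<close>, which leaves three origins.\<close>
      have top: "R (Suc (Suc k)) = max (F' (Suc (Suc k))) (R (Suc k))"
        unfolding R_def by (rule ladder_above[OF F'(1)]) simp
      consider "R (Suc (Suc k)) = R (Suc k)" | "R (Suc (Suc k)) = F (Suc (Suc k)) + e (Suc k)"
        | "R (Suc (Suc k)) = F (Suc k) + c k + e (Suc k)"
        using top F'(4) by linarith
      then show ?thesis
      proof cases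
        case 1
        show ?thesis unfolding eq q 1 using low[of k] by (meson le_SucI less_SucI order_refl)
      next
        case 2
        then show ?thesis unfolding eq q by (intro disjI1 exI[of _ "Suc k"]) simp
      next
        case 3
        then show ?thesis unfolding eq q by (intro disjI2 exI[of _ k]) simp
      qed
    qed
  qed
  then show thesis using stay jump by blast
qed

text \<open>
  The matrices realised below have diagonal entries \<open>lam + d x i\<close>, and their only entries carrying
  the additional bonus \<open>mu\<close> are those that pass from level \<open>i\<close> to level \<open>i + 1\<close> under the letter
  \<open>w i\<close>.  Level \<open>i\<close> is the prefix sum at \<open>Suc i\<close>.
\<close>

locale level_words =
  fixes X :: "'x set" and \<psi> :: "'x \<Rightarrow> nat list" and w :: "nat \<Rightarrow> 'x" and k :: nat
    and d :: "'x \<Rightarrow> nat \<Rightarrow> int" and C mu lam :: int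
  assumes bound: "x \<in> X \<Longrightarrow> i \<le> k \<Longrightarrow> \<bar>d x i\<bar> \<le> C"
    and C: "0 \<le> C" "C \<le> mu"
    and stay: "x \<in> X \<Longrightarrow> mono F \<Longrightarrow> i \<le> k \<Longrightarrow>
          int (F (Suc i)) + lam + d x i \<le> int (foldl lift F (\<psi> x) (Suc i))"
    and jump: "w i \<in> X \<Longrightarrow> mono F \<Longrightarrow> i < k \<Longrightarrow>
          int (F (Suc i)) + lam + mu \<le> int (foldl lift F (\<psi> (w i)) (Suc (Suc i)))"
    and step_cases: "x \<in> X \<Longrightarrow> mono F \<Longrightarrow> j \<le> k \<Longrightarrow>
          (\<exists>i\<le>j. int (foldl lift F (\<psi> x) (Suc j)) \<le> int (F (Suc i)) + lam + d x i) \<or>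
          (\<exists>i<j. x = w i \<and> int (foldl lift F (\<psi> x) (Suc j)) \<le> int (F (Suc i)) + lam + mu)"

text \<open>
  A ladder has diagonal entries \<open>c i + e i\<close> and entries \<open>c i + e (i + 1)\<close> above the diagonal, and
  an entry further up is only the maximum of those: as the blocks descend, at most one bonus is
  collected per ladder.  Prescribing these entries determines \<open>c\<close> by descending recursion.
\<close>

lemma level_words_exist:
  fixes d :: "'x \<Rightarrow> nat \<Rightarrow> int"
  assumes bound: "\<And>x i. x \<in> X \<Longrightarrow> i \<le> k \<Longrightarrow> \<bar>d x i\<bar> \<le> C" and C: "0 \<le> C" "C \<le> mu"
  obtains \<psi> lam where "\<forall>x. \<psi> x \<in> lists {1..Suc k}" "level_words X \<psi> w k d C mu lam"
proof -
  \<comment> \<open>The entries prescribe \<open>c i + e i = lam + d i\<close> and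
    \<open>c i + e (i + 1) = lam + d (i + 1) + g i\<close>, hence
    \<open>c i = g i + c (i + 1)\<close>. The value of \<open>g\<close> turns the second entry into
    \<open>lam + mu\<close> for the letter \<open>w i\<close>.\<close>
  define g where "g x l = (if x = w l then mu - d x (Suc l) else 0)" for x l
  define c where "c x i = sum (g x) {i..<k}" for x i
  \<comment> \<open>Large enough to make all exponents \<open>e\<close> nonnegative, so that
    \<open>nat\<close> loses nothing.\<close>
  define lam where "lam = int k * (mu + C) + C"
  define e where "e x i = lam + d x i - c x i" for x i
  define \<psi> where "\<psi> x = ladder (\<lambda>i. nat (c x i)) (\<lambda>i. nat (e x i)) k" for x
  have g: "0 \<le> g x l" "g x l \<le> mu + C" if "x \<in> X" "l < k" for x l
    using bound[of x "Suc l"] C that by (auto simp: g_def abs_le_iff)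
  have c_nonneg: "0 \<le> c x i" if "x \<in> X" for x i
    unfolding c_def using that by (intro sum_nonneg g) auto
  have c_le: "c x i \<le> int k * (mu + C)" if "x \<in> X" for x i
  proof -
    have "c x i \<le> int (card {i..<k}) * (mu + C)"
      unfolding c_def using that by (intro sum_bounded_above g) auto
    also have "\<dots> \<le> int k * (mu + C)" using C by (intro mult_right_mono) auto
    finally show ?thesis .
  qed
  have e_nonneg: "0 \<le> e x i" if "x \<in> X" "i \<le> k" for x i
    using c_le[OF that(1), of i] bound[OF that] by (simp add: e_def lam_def abs_le_iff)
  have c_k: "c x k = 0" for x by (simp add: c_def)
  have c_Suc: "c x i = g x i + c x (Suc i)" if "i < k" for x i
    unfolding c_def using that by (rule sum.atLeast_Suc_lessThan)
  have stay_val: "int (y + (if i < k then nat (c x i) else 0) + nat (e x i)) = int y + lam + d x i"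
    if "x \<in> X" "i \<le> k" for x i y
    using c_nonneg[OF that(1), of i] e_nonneg[OF that] c_k[of x] that(2)
    by (cases "i < k") (auto simp: e_def)
  have jump_val: "int (y + nat (c x i) + nat (e x (Suc i))) = int y + lam + d x (Suc i) + g x i"
    if "x \<in> X" "i < k" for x i y
    using c_nonneg[OF that(1), of i] e_nonneg[of x "Suc i"] c_Suc[OF that(2), of x] that
    by (simp add: e_def)
  have "level_words X \<psi> w k d C mu lam"
  proof
    fix x i and F :: "nat \<Rightarrow> nat" assume x: "x \<in> X" and F: "mono F" and i: "i \<le> k"
    show "int (F (Suc i)) + lam + d x i \<le> int (foldl lift F (\<psi> x) (Suc i))"
      using ladder_stay[OF F i, of "\<lambda>i. nat (c x i)" "\<lambda>i. nat (e x i)"]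
      unfolding stay_val[OF x i, symmetric] \<psi>_def by (simp only: of_nat_le_iff)
  next
    fix i and F :: "nat \<Rightarrow> nat" assume x: "w i \<in> X" and F: "mono F" and i: "i < k"
    have "int (F (Suc i)) + lam + mu = int (F (Suc i)) + lam + d (w i) (Suc i) + g (w i) i"
      by (simp add: g_def)
    then show "int (F (Suc i)) + lam + mu \<le> int (foldl lift F (\<psi> (w i)) (Suc (Suc i)))"
      using ladder_jump[OF F i, of "\<lambda>j. nat (c (w i) j)" "\<lambda>j. nat (e (w i) j)"]
      unfolding jump_val[OF x i, symmetric] \<psi>_def by (simp only: of_nat_le_iff)
  next
    fix x j and F :: "nat \<Rightarrow> nat" assume x: "x \<in> X" and F: "mono F" and j: "j \<le> k"
    show "(\<exists>i\<le>j. int (foldl lift F (\<psi> x) (Suc j)) \<le> int (F (Suc i)) + lam + d x i) \<or>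
      (\<exists>i<j. x = w i \<and> int (foldl lift F (\<psi> x) (Suc j)) \<le> int (F (Suc i)) + lam + mu)"
      using F j
    proof (cases rule: ladder_cases[where c = "\<lambda>i. nat (c x i)" and e = "\<lambda>i. nat (e x i)"])
      case (stay r)
      then have "int (foldl lift F (\<psi> x) (Suc j)) = int (F (Suc r)) + lam + d x r"
        using stay_val[OF x, of r "F (Suc r)"] j by (simp only: \<psi>_def le_trans)
      then show ?thesis using stay(1) by (intro disjI1 exI[of _ r]) simp
    next
      case (jump r)
      then have val: "int (foldl lift F (\<psi> x) (Suc j)) = int (F (Suc r)) + lam + d x (Suc r) + g x r"
        using jump_val[OF x, of r "F (Suc r)"] j by (simp only: \<psi>_def less_le_trans)
      show ?thesis
      proof (cases "x = w r")
        case True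
        with val jump(1) show ?thesis by (intro disjI2 exI[of _ r]) (simp add: g_def)
      next
        \<comment> \<open>Without a bonus, the climb weighs as much as a stay at level
          \<open>r + 1\<close>, which starts no lower.\<close>
        case False
        with val jump(1) monoD[OF F, of "Suc r" "Suc (Suc r)"] show ?thesis
          by (intro disjI1 exI[of _ "Suc r"]) (simp add: g_def)
      qed
    qed
  qed (use bound C in auto)
  moreover have "\<psi> x \<in> lists {1..Suc k}" for x
    unfolding \<psi>_def by (rule ladder_in_lists)
  ultimately show thesis using that by blast
qed

section \<open>Occurrences of a scattered subword\<close>

text \<open>
  \<open>occurrence w v j ls\<close>: the word \<open>w 0 \<dots> w (j - 1)\<close> occurs in \<open>v\<close> as a scattered subword, and
  \<open>ls\<close> lists the letters of \<open>v\<close> outside this occurrence, each together with the number of letters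
  of the occurrence that precede it.
\<close>

inductive occurrence :: "(nat \<Rightarrow> 'x) \<Rightarrow> 'x list \<Rightarrow> nat \<Rightarrow> ('x \<times> nat) list \<Rightarrow> bool" for w where
  Nil: "occurrence w [] 0 []"
| skip: "occurrence w v j ls \<Longrightarrow> occurrence w (v @ [x]) j ((x, j) # ls)"
| match: "occurrence w v j ls \<Longrightarrow> occurrence w (v @ [w j]) (Suc j) ls"

lemma occurrence_set: "occurrence w v j ls \<Longrightarrow> set ls \<subseteq> set v \<times> {..j}"
  by (induction rule: occurrence.induct) auto

lemma occurrence_length: "occurrence w v j ls \<Longrightarrow> length ls + j = length v"
  by (induction rule: occurrence.induct) auto

text \<open>Allows \<open>w\<close> to be redefined at \<open>j\<close> when a path takes one more
  move.\<close>

lemma occurrence_cong: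
  "occurrence w v j ls \<Longrightarrow> (\<And>i. i < j \<Longrightarrow> w i = w' i) \<Longrightarrow> occurrence w' v j ls"
proof (induction rule: occurrence.induct)
  case Nil
  show ?case by (rule occurrence.Nil)
next
  case (skip v j ls x)
  then show ?case by (intro occurrence.skip) simp
next
  case (match v j ls)
  then have "occurrence w' (v @ [w' j]) (Suc j) ls" by (intro occurrence.match) simp
  then show ?case using match.prems[of j] by simp
qed

text \<open>Finiteness allows one scaling factor to serve all competing occurrences.\<close>

lemma finite_occurrences: "finite {ls. occurrence w v j ls}"
proof (rule finite_subset)
  show "{ls. occurrence w v j ls} \<subseteq> {ls. set ls \<subseteq> set v \<times> {..j} \<and> length ls \<le> length v}"
    using occurrence_set[of w v j] occurrence_length[of w v j] by fastforce
  show "finite {ls. set ls \<subseteq> set v \<times> {..j} \<and> length ls \<le> length v}"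
    by (intro finite_lists_length_le) simp
qed

section \<open>Heights reached by the realising words\<close>

context level_words
begin

definition height :: "'x list \<Rightarrow> nat \<Rightarrow> int" where
  "height v j = int (foldl lift (\<lambda>_. 0) (concat (map \<psi> v)) (Suc j))"

lemma mono_state: "mono (foldl lift (\<lambda>_. 0) (concat (map \<psi> v)))"
  by (rule mono_foldl_lift) (simp add: mono_def)

text \<open>The occurrence is a path: letters in \<open>ls\<close> are read on loops, the matched
  ones climb and collect a bonus.\<close>

lemma height_ge_occurrence:
  assumes "occurrence w v j ls" "j \<le> k" "set v \<subseteq> X"
  shows "int (length v) * lam + int j * mu + (\<Sum>(x, i)\<leftarrow>ls. d x i) \<le> height v j"
  using assms
proof (induction rule: occurrence.induct)
  case Nil
  show ?case by (simp add: height_def)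
next
  case (skip v j ls x)
  then show ?case
    using stay[OF _ mono_state, of x j v] by (auto simp: height_def algebra_simps)
next
  case (match v j ls)
  then show ?case
    using jump[OF _ mono_state, of j v] by (auto simp: height_def algebra_simps)
qed

text \<open>
  A path from level 0 to level \<open>j\<close> collects at most \<open>j\<close> bonuses, with equality only if it
  climbs one level at a time, each time reading the required letter.
\<close>

lemma height_cases:
  assumes "set v \<subseteq> X" "j \<le> k"
  shows "height v j \<le> int (length v) * (lam + C) + (int j - 1) * mu \<or>
    (\<exists>ls. occurrence w v j ls \<and>
          height v j \<le> int (length v) * lam + int j * mu + (\<Sum>(x, i)\<leftarrow>ls. d x i))"
  using assms
proof (induction v arbitrary: j rule: rev_induct)
  case Nil
  show ?case
  proof (cases j)
    case 0
    then show ?thesis by (auto simp: height_def intro: occurrence.Nil)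
  next
    \<comment> \<open>All levels start at 0, so a path may also begin at level \<open>j\<close>;
      this counts as having missed a bonus.\<close>
    case (Suc i)
    then show ?thesis using C by (simp add: height_def)
  qed
next
  case (snoc x v)
  let ?L = "int (length v)"
  have x: "x \<in> X" and v: "set v \<subseteq> X" using snoc.prems by auto
  \<comment> \<open>Common to both alternatives: \<open>lam + C\<close> per letter and at most
    \<open>i\<close> times \<open>mu\<close>.\<close>
  have weak: "height v i \<le> ?L * (lam + C) + int i * mu" if "i \<le> k" for i
    using snoc.IH[OF v that]
  proof (elim disjE exE conjE)
    fix ls assume ls: "occurrence w v i ls"
      and h: "height v i \<le> ?L * lam + int i * mu + (\<Sum>(x, i)\<leftarrow>ls. d x i)"
    have "(\<Sum>(x, i)\<leftarrow>ls. d x i) \<le> (\<Sum>_\<leftarrow>ls. C)"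
    proof (rule sum_list_mono)
      fix y assume "y \<in> set ls"
      then have "fst y \<in> X" "snd y \<le> k" using occurrence_set[OF ls] v that by fastforce+
      then show "(case y of (x, i) \<Rightarrow> d x i) \<le> C"
        using bound[of "fst y" "snd y"] by (simp add: case_prod_beta abs_le_iff)
    qed
    also have "\<dots> = int (length ls) * C" by (simp add: sum_list_triv)
    also have "\<dots> \<le> ?L * C"
      using occurrence_length[OF ls] C by (intro mult_right_mono) auto
    finally show ?thesis using h by (simp add: algebra_simps)
  qed (use C in \<open>simp add: algebra_simps\<close>)
  have lower: "int i * mu \<le> (int j - 1) * mu" if "i < j" for i
    using that C by (intro mult_right_mono) auto
  have step: "(\<exists>i\<le>j. height (v @ [x]) j \<le> height v i + lam + d x i) \<or>
      (\<exists>i<j. x = w i \<and> height (v @ [x]) j \<le> height v i + lam + mu)"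
    using step_cases[OF x mono_state snoc.prems(2), of v] by (simp add: height_def)
  then show ?case
  proof (elim disjE exE conjE)
    fix i assume i: "i \<le> j" and h: "height (v @ [x]) j \<le> height v i + lam + d x i"
    have dC: "d x i \<le> C" using bound[OF x, of i] i snoc.prems by (simp add: abs_le_iff)
    show ?thesis
    proof (cases "i = j")
      case False
      then have "height (v @ [x]) j \<le> (?L + 1) * (lam + C) + (int j - 1) * mu"
        using h dC weak[of i] lower[of i] i snoc.prems by (simp add: algebra_simps)
      then show ?thesis by (simp add: add.commute)
    next
      case True
      from snoc.IH[OF v snoc.prems(2)] show ?thesis
      proof (elim disjE exE conjE)
        assume "height v j \<le> ?L * (lam + C) + (int j - 1) * mu"
        then have "height (v @ [x]) j \<le> (?L + 1) * (lam + C) + (int j - 1) * mu"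
          using h dC True by (simp add: algebra_simps)
        then show ?thesis by (simp add: add.commute)
      next
        fix ls assume "occurrence w v j ls"
          and "height v j \<le> ?L * lam + int j * mu + (\<Sum>(x, i)\<leftarrow>ls. d x i)"
        then show ?thesis
          using h True by (intro disjI2 exI[of _ "(x, j) # ls"])
            (auto simp: algebra_simps intro: occurrence.skip)
      qed
    qed
  next
    fix i assume i: "i < j" "x = w i" and h: "height (v @ [x]) j \<le> height v i + lam + mu"
    show ?thesis
    proof (cases "Suc i = j")
      \<comment> \<open>Landing above level \<open>i + 1\<close> passes at least one level without
        collecting its bonus.\<close>
      case False
      then have "height (v @ [x]) j \<le> (?L + 1) * (lam + C) + (int j - 1) * mu"
        using h weak[of i] lower[of "Suc i"] i snoc.prems C by (simp add: algebra_simps)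
      then show ?thesis by (simp add: add.commute)
    next
      case True
      have "i \<le> k" using i snoc.prems by simp
      from snoc.IH[OF v this] show ?thesis
      proof (elim disjE exE conjE)
        assume "height v i \<le> ?L * (lam + C) + (int i - 1) * mu"
        then have "height (v @ [x]) j \<le> (?L + 1) * (lam + C) + (int j - 1) * mu"
          using h True C by (auto simp: algebra_simps)
        then show ?thesis by (simp add: add.commute)
      next
        fix ls assume "occurrence w v i ls"
          and "height v i \<le> ?L * lam + int i * mu + (\<Sum>(x, i)\<leftarrow>ls. d x i)"
        then show ?thesis
          using h True i(2) occurrence.match[of w v i ls]
          by (intro disjI2 exI[of _ ls]) (auto simp: algebra_simps)
      qed
    qed
  qed
qed

end

text \<open>Equal lengths cancel \<open>lam\<close>. A path for \<open>v\<close> with fewer than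
  \<open>k\<close> bonuses loses by the size of \<open>mu\<close>; one with all \<open>k\<close>
  comes from an occurrence of \<open>w\<close> and loses by assumption. So level \<open>k\<close>
  ends higher after \<open>u\<close>.\<close>

lemma grammic_separation:
  fixes d :: "'x \<Rightarrow> nat \<Rightarrow> int"
  assumes len: "length u = length v" and kn: "k < n" and u: "occurrence w u k lu"
    and less: "\<And>ls. occurrence w v k ls \<Longrightarrow> (\<Sum>(x, i)\<leftarrow>ls. d x i) < (\<Sum>(x, i)\<leftarrow>lu. d x i)"
  obtains \<psi> where "\<And>x. \<psi> x \<in> lists {1..n}"
    "act_word n (\<lambda>_. 0) (concat (map \<psi> u)) \<noteq> act_word n (\<lambda>_. 0) (concat (map \<psi> v))"
proof -
  define X where "X = set u \<union> set v"
  define C where "C = (\<Sum>(x, i)\<in>X \<times> {..k}. \<bar>d x i\<bar>)"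
  \<comment> \<open>Bounding the loops by \<open>C\<close>, the path for \<open>u\<close> beats
    \<open>k - 1\<close> bonuses by at least \<open>mu - 2 * length u * C\<close>, which must be
    positive; the summand \<open>C\<close> gives \<open>C \<le> mu\<close>.\<close>
  define mu where "mu = 2 * int (length u) * C + C + 1"
  have bound: "\<bar>d x i\<bar> \<le> C" if "x \<in> X" "i \<le> k" for x i
  proof -
    have "finite (X \<times> {..k})" by (simp add: X_def)
    from member_le_sum[OF _ _ this, of "(x, i)" "\<lambda>(x, i). \<bar>d x i\<bar>"]
    show ?thesis using that by (auto simp: C_def)
  qed
  have C: "0 \<le> C" unfolding C_def by (rule sum_nonneg) auto
  then have "C \<le> mu" by (simp add: mu_def)
  with bound C obtain \<psi> lam where \<psi>: "\<forall>x. \<psi> x \<in> lists {1..Suc k}"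
    and "level_words X \<psi> w k d C mu lam"
    by (rule level_words_exist[where w = w]) blast
  then interpret level_words X \<psi> w k d C mu lam by simp
  have uX: "set u \<subseteq> X" and vX: "set v \<subseteq> X" by (auto simp: X_def)
  have hu: "int (length u) * lam + int k * mu + (\<Sum>(x, i)\<leftarrow>lu. d x i) \<le> height u k"
    by (rule height_ge_occurrence[OF u order_refl uX])
  have "- (int (length u) * C) \<le> - (int (length lu) * C)"
    using occurrence_length[OF u] C by (simp add: mult_right_mono)
  also have "\<dots> = (\<Sum>_\<leftarrow>lu. - C)" by (simp add: sum_list_triv)
  also have "\<dots> \<le> (\<Sum>(x, i)\<leftarrow>lu. d x i)"
  proof (rule sum_list_mono)
    fix y assume "y \<in> set lu"
    then have "fst y \<in> X" "snd y \<le> k" using occurrence_set[OF u] uX by fastforce+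
    then show "- C \<le> (case y of (x, i) \<Rightarrow> d x i)"
      using bound[of "fst y" "snd y"] by (simp add: case_prod_beta abs_le_iff)
  qed
  finally have "- (int (length u) * C) \<le> (\<Sum>(x, i)\<leftarrow>lu. d x i)" .
  then have low: "int (length u) * (lam - C) + int k * mu \<le> height u k"
    using hu by (simp add: algebra_simps)
  from height_cases[OF vX order_refl] have "height v k < height u k"
  proof (elim disjE exE conjE)
    assume "height v k \<le> int (length v) * (lam + C) + (int k - 1) * mu"
    moreover have "2 * (int (length u) * C) < mu" using C by (simp add: mu_def)
    ultimately show ?thesis using low len by (simp add: algebra_simps)
  next
    fix ls assume "occurrence w v k ls"
      and "height v k \<le> int (length v) * lam + int k * mu + (\<Sum>(x, i)\<leftarrow>ls. d x i)"
    then show ?thesis using less[of ls] hu len by simp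
  qed
  moreover have zero: "(\<lambda>_. 0) \<in> nat_vecs n" by (simp add: nat_vecs_def)
  have zero_sum: "prefix_sum (\<lambda>_. 0) = (\<lambda>_. 0)" by (simp add: prefix_sum_def fun_eq_iff)
  have \<psi>n: "\<psi> x \<in> lists {1..n}" for x
    using \<psi>[rule_format, of x] kn by (auto simp: in_lists_conv_set)
  then have "concat (map \<psi> z) \<in> lists {1..n}" for z
    by (induction z) auto
  then have "height z k = int (prefix_sum (act_word n (\<lambda>_. 0) (concat (map \<psi> z))) (Suc k))" for z
    by (simp add: height_def prefix_sum_act_word[OF zero] zero_sum)
  ultimately show thesis using that[of \<psi>, OF \<psi>n] by force
qed


section \<open>Entries of products of tropical matrices\<close>

text \<open>The value at \<open>MInfty\<close> is a filler; path weights are compared only along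
  finite entries.\<close>

primrec finite_part :: "trop \<Rightarrow> real" where
  "finite_part MInfty = 0"
| "finite_part (Fin a) = a"

lemma times_trop_Fin_iff: "a * b = Fin r \<longleftrightarrow> (\<exists>x y. a = Fin x \<and> b = Fin y \<and> r = x + y)"
  by (cases a; cases b) auto

lemma sum_trop_FinD:
  assumes "finite S" "sum f S = Fin r"
  shows "\<exists>s\<in>S. f s = Fin r"
  using assms
proof (induction S arbitrary: r rule: finite_induct)
  case empty
  then show ?case by (simp add: zero_trop_def)
next
  case (insert s S)
  then show ?case by (cases "f s"; cases "sum f S") (auto simp: max_def split: if_splits)
qed

lemma sum_trop_FinI:
  assumes "finite S" "s \<in> S" "f s = Fin a"
  shows "\<exists>r\<ge>a. sum f S = Fin r"
  using assms by (cases "sum f (S - {s})") (auto simp: sum.remove)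

lemma sum_trop_eqI:
  assumes S: "finite S" "s \<in> S" "f s = Fin b"
    and le: "\<And>i a. i \<in> S \<Longrightarrow> f i = Fin a \<Longrightarrow> a \<le> b"
  shows "sum f S = Fin b"
  using sum_trop_FinI[of S s f b] sum_trop_FinD[of S f] S le by (metis order_antisym)

lemma carrier_UT_trop: "carrier (UT_trop n) = {A \<in> carrier_mat n n. upper_triangular A}"
  by (simp add: UT_trop_def)

lemma mult_UT_trop: "mult (UT_trop n) = (*)"
  by (simp add: UT_trop_def)

lemma one_UT_trop: "one (UT_trop n) = 1\<^sub>m n"
  by (simp add: UT_trop_def)

lemma eval_word_UT_snoc_entry:
  assumes "A ` set (u @ [x]) \<subseteq> carrier (UT_trop n)" "p < n" "q < n"
  shows "eval_word (UT_trop n) A (u @ [x]) $$ (p, q) =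
         (\<Sum>s<n. eval_word (UT_trop n) A u $$ (p, s) * A x $$ (s, q))"
proof -
  have "eval_word (UT_trop n) A u \<in> carrier (UT_trop n)" "A x \<in> carrier (UT_trop n)"
    using assms(1) by (auto intro!: eval_word_closed monoid_UT_trop)
  then have "eval_word (UT_trop n) A u \<in> carrier_mat n n" "A x \<in> carrier_mat n n"
    by (simp_all add: carrier_UT_trop)
  moreover have "eval_word (UT_trop n) A (u @ [x]) = eval_word (UT_trop n) A u * A x"
    using assms(1) eval_word_snoc[OF monoid_UT_trop, of A u n x] by (simp add: mult_UT_trop)
  ultimately show ?thesis
    using assms(2,3) by (simp add: scalar_prod_def lessThan_atLeast0)
qed

text \<open>
  The weight of a path through the states \<open>t 0, \<dots>, t j\<close> that moves from \<open>t i\<close> to \<open>t (i + 1)\<close>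
  on the letter \<open>w i\<close> and reads the letters listed in \<open>ls\<close> on loops.
\<close>

definition path_weight ::
    "('x \<Rightarrow> trop mat) \<Rightarrow> (nat \<Rightarrow> nat) \<Rightarrow> (nat \<Rightarrow> 'x) \<Rightarrow> nat \<Rightarrow> ('x \<times> nat) list \<Rightarrow> real" where
  "path_weight A t w j ls =
     (\<Sum>(x, i)\<leftarrow>ls. finite_part (A x $$ (t i, t i))) +
     (\<Sum>i<j. finite_part (A (w i) $$ (t i, t (Suc i))))"

text \<open>The occurrence describes a path from \<open>t 0\<close> to \<open>t j\<close>; each
  letter picks one term of a tropical sum, which bounds that sum from below.\<close>

lemma path_weight_le_entry:
  assumes "occurrence w v j ls" "A ` set v \<subseteq> carrier (UT_trop n)" "\<And>i. i \<le> j \<Longrightarrow> t i < n"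
    and "\<And>x i. (x, i) \<in> set ls \<Longrightarrow> A x $$ (t i, t i) \<noteq> MInfty"
    and "\<And>i. i < j \<Longrightarrow> A (w i) $$ (t i, t (Suc i)) \<noteq> MInfty"
  shows "\<exists>r\<ge>path_weight A t w j ls. eval_word (UT_trop n) A v $$ (t 0, t j) = Fin r"
  using assms
proof (induction rule: occurrence.induct)
  case Nil
  then show ?case by (simp add: path_weight_def one_UT_trop one_trop_def)
next
  case (skip v j ls x)
  then obtain r where r: "path_weight A t w j ls \<le> r"
    "eval_word (UT_trop n) A v $$ (t 0, t j) = Fin r" by auto
  have "A x $$ (t j, t j) \<noteq> MInfty" using skip.prems by simp
  then obtain a where a: "A x $$ (t j, t j) = Fin a" by (cases "A x $$ (t j, t j)") auto
  have "\<exists>r'\<ge>r + a. (\<Sum>s<n. eval_word (UT_trop n) A v $$ (t 0, s) * A x $$ (s, t j)) = Fin r'"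
    by (rule sum_trop_FinI[of _ "t j"]) (use r a skip.prems(2) in auto)
  then obtain r' where r': "r + a \<le> r'"
    "eval_word (UT_trop n) A (v @ [x]) $$ (t 0, t j) = Fin r'"
    using eval_word_UT_snoc_entry[OF skip.prems(1), of "t 0" "t j"] skip.prems(2) by auto
  then show ?case using r(1) a by (intro exI[of _ r']) (auto simp: path_weight_def)
next
  case (match v j ls)
  then obtain r where r: "path_weight A t w j ls \<le> r"
    "eval_word (UT_trop n) A v $$ (t 0, t j) = Fin r" by auto
  have "A (w j) $$ (t j, t (Suc j)) \<noteq> MInfty" using match.prems by simp
  then obtain a where a: "A (w j) $$ (t j, t (Suc j)) = Fin a"
    by (cases "A (w j) $$ (t j, t (Suc j))") auto
  have "\<exists>r'\<ge>r + a. (\<Sum>s<n. eval_word (UT_trop n) A v $$ (t 0, s) * A (w j) $$ (s, t (Suc j))) = Fin r'"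
    by (rule sum_trop_FinI[of _ "t j"]) (use r a match.prems(2) in auto)
  then obtain r' where r': "r + a \<le> r'"
    "eval_word (UT_trop n) A (v @ [w j]) $$ (t 0, t (Suc j)) = Fin r'"
    using eval_word_UT_snoc_entry[OF match.prems(1), of "t 0" "t (Suc j)"] match.prems(2) by auto
  then show ?case using r(1) a by (intro exI[of _ r']) (auto simp: path_weight_def)
qed

text \<open>Backtracking through attained maxima gives an optimal path; triangularity makes its
  states nondecreasing, so each letter is a loop or a strict move.\<close>

lemma entry_FinE:
  assumes "A ` set u \<subseteq> carrier (UT_trop n)" "p < n" "q < n"
    and "eval_word (UT_trop n) A u $$ (p, q) = Fin r"
  obtains t w k ls where "occurrence w u k ls" "t 0 = p" "t k = q"
    "\<And>i. i < k \<Longrightarrow> t i < t (Suc i)"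
    "\<And>x i. (x, i) \<in> set ls \<Longrightarrow> A x $$ (t i, t i) \<noteq> MInfty"
    "\<And>i. i < k \<Longrightarrow> A (w i) $$ (t i, t (Suc i)) \<noteq> MInfty"
    "r = path_weight A t w k ls"
proof -
  have "\<exists>t w k ls. occurrence w u k ls \<and> t 0 = p \<and> t k = q \<and> (\<forall>i<k. t i < t (Suc i)) \<and>
    (\<forall>(x, i)\<in>set ls. A x $$ (t i, t i) \<noteq> MInfty) \<and>
    (\<forall>i<k. A (w i) $$ (t i, t (Suc i)) \<noteq> MInfty) \<and> r = path_weight A t w k ls"
    using assms(1,3,4)
  proof (induction u arbitrary: q r rule: rev_induct)
    case Nil
    then have "p = q" "r = 0"
      using assms(2) by (auto simp: one_UT_trop one_trop_def zero_trop_def split: if_splits)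
    then show ?case
      by (intro exI[of _ "\<lambda>_. p"] exI[of _ "\<lambda>_. undefined"] exI[of _ 0] exI[of _ "[]"])
        (simp add: occurrence.Nil path_weight_def)
  next
    case (snoc x u)
    have "(\<Sum>s<n. eval_word (UT_trop n) A u $$ (p, s) * A x $$ (s, q)) = Fin r"
      using eval_word_UT_snoc_entry[OF snoc.prems(1) assms(2) snoc.prems(2)] snoc.prems(3) by simp
    from sum_trop_FinD[OF _ this] obtain s a b where s: "s < n"
      and a: "eval_word (UT_trop n) A u $$ (p, s) = Fin a" and b: "A x $$ (s, q) = Fin b"
      and r: "r = a + b"
      by (auto simp: times_trop_Fin_iff)
    have "A ` set u \<subseteq> carrier (UT_trop n)" using snoc.prems(1) by simp
    from snoc.IH[OF this s a] obtain t w k ls where occ: "occurrence w u k ls"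
      and t: "t 0 = p" "t k = s" "\<forall>i<k. t i < t (Suc i)"
      and fin: "\<forall>(x, i)\<in>set ls. A x $$ (t i, t i) \<noteq> MInfty"
        "\<forall>i<k. A (w i) $$ (t i, t (Suc i)) \<noteq> MInfty"
      and wt: "a = path_weight A t w k ls" by blast
    have "s \<le> q"
    proof (rule ccontr)
      assume "\<not> s \<le> q"
      then have "A x $$ (s, q) = 0"
        using snoc.prems(1) s by (intro upper_triangularD) (auto simp: carrier_UT_trop)
      then show False using b by (simp add: zero_trop_def)
    qed
    then consider "s = q" | "s < q" by linarith
    then show ?case
    proof cases
      case 1
      show ?thesis
        using occurrence.skip[OF occ, of x] t fin wt b r 1
        by (intro exI[of _ t] exI[of _ w] exI[of _ k] exI[of _ "(x, k) # ls"])
          (auto simp: path_weight_def)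
    next
      case 2
      \<comment> \<open>The earlier path uses \<open>t\<close> only up to \<open>k\<close> and
        \<open>w\<close> only below \<open>k\<close>, so both can be extended at the next
        index.\<close>
      define t' where "t' = t(Suc k := q)"
      define w' where "w' = w(k := x)"
      have "occurrence w' u k ls"
        by (rule occurrence_cong[OF occ]) (simp add: w'_def)
      from occurrence.match[OF this] have occ': "occurrence w' (u @ [x]) (Suc k) ls"
        by (simp add: w'_def)
      have le: "i \<le> k" if "(y, i) \<in> set ls" for y i
        using occurrence_set[OF occ] that by auto
      have same: "t' i = t i" if "i \<le> k" for i using that by (simp add: t'_def)
      have samew: "w' i = w i" if "i < k" for i using that by (simp add: w'_def)
      have vals: "t' (Suc k) = q" "t' k = s" "w' k = x" using t(2) by (simp_all add: t'_def w'_def)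
      have "(\<Sum>(y, i)\<leftarrow>ls. finite_part (A y $$ (t' i, t' i))) =
          (\<Sum>(y, i)\<leftarrow>ls. finite_part (A y $$ (t i, t i)))"
        using le same by (intro arg_cong[of _ _ sum_list] map_cong) auto
      moreover have "(\<Sum>i<k. finite_part (A (w' i) $$ (t' i, t' (Suc i)))) =
          (\<Sum>i<k. finite_part (A (w i) $$ (t i, t (Suc i))))"
        using same samew by (intro sum.cong) auto
      ultimately have "path_weight A t' w' (Suc k) ls = a + b"
        using wt b by (simp add: path_weight_def vals)
      moreover have "\<forall>i<Suc k. t' i < t' (Suc i)"
        using t 2 by (auto simp: t'_def less_Suc_eq)
      moreover have "\<forall>(y, i)\<in>set ls. A y $$ (t' i, t' i) \<noteq> MInfty"
        using fin(1) le same by auto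
      moreover have "\<forall>i<Suc k. A (w' i) $$ (t' i, t' (Suc i)) \<noteq> MInfty"
        using fin(2) b t(2) by (auto simp: t'_def w'_def less_Suc_eq)
      moreover have "t' 0 = p" "t' (Suc k) = q" using t(1) by (auto simp: t'_def)
      ultimately show ?thesis
        using occ' r by (intro exI[of _ t'] exI[of _ w'] exI[of _ "Suc k"] exI[of _ ls]) simp
    qed
  qed
  then show thesis using that by blast
qed

section \<open>Integer weights\<close>

lemma sum_list_floor_bounds:
  fixes f :: "'y \<Rightarrow> real"
  shows "(\<Sum>y\<leftarrow>ys. f y) - length ys \<le> of_int (\<Sum>y\<leftarrow>ys. \<lfloor>f y\<rfloor>)"
    and "of_int (\<Sum>y\<leftarrow>ys. \<lfloor>f y\<rfloor>) \<le> (\<Sum>y\<leftarrow>ys. f y)"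
proof (induction ys)
  case (Cons y ys)
  {
    case 1
    show ?case using Cons(1) by simp (use real_of_int_floor_add_one_ge[of "f y"] in linarith)
  next
    case 2
    show ?case using Cons(2) by simp (use of_int_floor_le[of "f y"] in linarith)
  }
qed simp_all

text \<open>
  Rounding a large multiple of the weights down to integers, with a weight \<open>-K\<close> in the place
  of \<open>-\<infinity>\<close>, preserves finitely many strict inequalities.
\<close>

lemma integer_weights:
  fixes D :: "'y \<Rightarrow> trop"
  assumes fin: "finite Ls" and lu: "\<forall>y\<in>set lu. D y \<noteq> MInfty"
    and less: "\<And>ls. ls \<in> Ls \<Longrightarrow> \<forall>y\<in>set ls. D y \<noteq> MInfty \<Longrightarrow>
      (\<Sum>y\<leftarrow>ls. finite_part (D y)) < (\<Sum>y\<leftarrow>lu. finite_part (D y))"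
  obtains d :: "'y \<Rightarrow> int" where "\<And>ls. ls \<in> Ls \<Longrightarrow> (\<Sum>y\<leftarrow>ls. d y) < (\<Sum>y\<leftarrow>lu. d y)"
proof -
  \<comment> \<open>The same \<open>K\<close> is penalty and scaling factor: after scaling,
    \<open>MInfty\<close> costs \<open>K * K\<close>, which outgrows the finite weights times
    \<open>K\<close>.\<close>
  define val where "val K y = (if D y = MInfty then - K else finite_part (D y))" for K y
  define U where "U = (\<Sum>y\<leftarrow>lu. finite_part (D y))"
  \<comment> \<open>Rounding down costs \<open>lu\<close> at most \<open>length lu\<close> and never
    raises the other side; the 1 gives strictness.\<close>
  define N where "N = real (length lu) + 1"
  have "\<forall>\<^sub>F K :: real in at_top. (\<Sum>y\<leftarrow>ls. \<lfloor>K * val K y\<rfloor>) < (\<Sum>y\<leftarrow>lu. \<lfloor>K * val K y\<rfloor>)"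
    if ls: "ls \<in> Ls" for ls
  proof -
    have "\<exists>B. \<forall>K\<ge>B. K * (\<Sum>y\<leftarrow>ls. val K y) + N \<le> K * U"
    proof (cases "\<forall>y\<in>set ls. D y \<noteq> MInfty")
      case True
      define V where "V = (\<Sum>y\<leftarrow>ls. finite_part (D y))"
      have V: "V < U" using less[OF ls True] by (simp add: V_def U_def)
      have "(\<Sum>y\<leftarrow>ls. val K y) = V" for K
        unfolding V_def using True by (intro arg_cong[of _ _ sum_list] map_cong) (auto simp: val_def)
      moreover have "K * V + N \<le> K * U" if "K \<ge> N / (U - V)" for K
        using that V by (simp add: field_simps)
      ultimately show ?thesis by auto
    next
      case False
      define R where "R = (\<Sum>y\<leftarrow>ls. \<bar>finite_part (D y)\<bar>)"
      have val_le: "(\<Sum>y\<leftarrow>ls. val K y) \<le> R - K" if "0 \<le> K" for K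
      proof -
        have mono: "(\<Sum>y\<leftarrow>zs. val K y) \<le> (\<Sum>y\<leftarrow>zs. \<bar>finite_part (D y)\<bar>)" for zs
          using that by (intro sum_list_mono) (auto simp: val_def)
        obtain z xs ys where "ls = xs @ z # ys" "D z = MInfty"
          using False by (metis split_list)
        then show ?thesis using mono[of xs] mono[of ys] by (simp add: R_def val_def)
      qed
      \<comment> \<open>The threshold yields \<open>R - K \<le> U - N\<close>, and
        \<open>K \<ge> 1\<close> preserves the gap \<open>N\<close> under scaling.\<close>
      have "K * (\<Sum>y\<leftarrow>ls. val K y) + N \<le> K * U" if K: "K \<ge> N + \<bar>R\<bar> + \<bar>U\<bar>" for K
      proof -
        have K1: "1 \<le> K" using K by (simp add: N_def)
        have "(\<Sum>y\<leftarrow>ls. val K y) \<le> U - N" using val_le[of K] K1 K by linarith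
        then have "K * (\<Sum>y\<leftarrow>ls. val K y) \<le> K * (U - N)"
          using K1 by (intro mult_left_mono) auto
        moreover have "N \<le> K * N"
          using K1 mult_right_mono[of 1 K N] by (simp add: N_def)
        ultimately show ?thesis by (simp add: algebra_simps)
      qed
      then show ?thesis by blast
    qed
    then obtain B where B: "\<forall>K\<ge>B. K * (\<Sum>y\<leftarrow>ls. val K y) + N \<le> K * U" by blast
    have "(\<Sum>y\<leftarrow>ls. \<lfloor>K * val K y\<rfloor>) < (\<Sum>y\<leftarrow>lu. \<lfloor>K * val K y\<rfloor>)" if "K \<ge> B" for K
    proof -
      have "(\<Sum>y\<leftarrow>lu. val K y) = U"
        unfolding U_def using lu by (intro arg_cong[of _ _ sum_list] map_cong) (auto simp: val_def)
      then have "(\<Sum>y\<leftarrow>lu. K * val K y) = K * U"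
        by (simp add: sum_list_const_mult)
      then have "K * U - real (length lu) \<le> of_int (\<Sum>y\<leftarrow>lu. \<lfloor>K * val K y\<rfloor>)"
        using sum_list_floor_bounds(1)[of "\<lambda>y. K * val K y" lu] by simp
      moreover have "of_int (\<Sum>y\<leftarrow>ls. \<lfloor>K * val K y\<rfloor>) \<le> K * (\<Sum>y\<leftarrow>ls. val K y)"
        using sum_list_floor_bounds(2)[of "\<lambda>y. K * val K y" ls] by (simp add: sum_list_const_mult)
      moreover have "K * (\<Sum>y\<leftarrow>ls. val K y) + N \<le> K * U" using B that by blast
      ultimately have "real_of_int (\<Sum>y\<leftarrow>ls. \<lfloor>K * val K y\<rfloor>) < of_int (\<Sum>y\<leftarrow>lu. \<lfloor>K * val K y\<rfloor>)"
        unfolding N_def by linarith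
      then show ?thesis by (simp only: of_int_less_iff)
    qed
    then show ?thesis unfolding eventually_at_top_linorder by blast
  qed
  then have "\<forall>\<^sub>F K :: real in at_top. \<forall>ls\<in>Ls.
      (\<Sum>y\<leftarrow>ls. \<lfloor>K * val K y\<rfloor>) < (\<Sum>y\<leftarrow>lu. \<lfloor>K * val K y\<rfloor>)"
    using fin by (simp add: eventually_ball_finite_distrib)
  then obtain K :: real where "\<forall>ls\<in>Ls. (\<Sum>y\<leftarrow>ls. \<lfloor>K * val K y\<rfloor>) < (\<Sum>y\<leftarrow>lu. \<lfloor>K * val K y\<rfloor>)"
    unfolding eventually_at_top_linorder by blast
  then show thesis using that by blast
qed

section \<open>Comparing the identities\<close>

text \<open>Sending every letter to 1 makes the first prefix sum count letters.\<close>

lemma grammic_identity_length: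
  assumes n: "n \<ge> 1"
    and eq: "\<And>\<phi>. (\<And>x. \<phi> x \<in> lists {1..n}) \<Longrightarrow>
      act_word n (\<lambda>_. 0) (concat (map \<phi> u)) = act_word n (\<lambda>_. 0) (concat (map \<phi> v))"
  shows "length u = length v"
proof -
  have one: "concat (map (\<lambda>_. [1]) z) = replicate (length z) (1::nat)" for z :: "'x list"
    by (induction z) auto
  have "prefix_sum (act_word n (\<lambda>_. 0) (replicate l 1)) 1 = l" for l
    using n by (subst prefix_sum_act_word)
      (auto simp: nat_vecs_def prefix_sum_def foldl_lift_replicate mono_def)
  then show ?thesis using eq[of "\<lambda>_. [1]"] n unfolding one by (metis atLeastAtMost_iff lists.simps order_refl)
qed

text \<open>If the claim fails, an optimal path for \<open>u\<close> beats every occurrence of its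
  moves in \<open>v\<close>, and \<open>grammic_separation\<close> gives a substitution that breaks
  the identity.\<close>

lemma UT_entry_le_of_grammic:
  assumes eq: "\<And>\<phi>. (\<And>x. \<phi> x \<in> lists {1..n}) \<Longrightarrow>
      act_word n (\<lambda>_. 0) (concat (map \<phi> u)) = act_word n (\<lambda>_. 0) (concat (map \<phi> v))"
    and len: "length u = length v"
    and A: "A ` set u \<subseteq> carrier (UT_trop n)" "A ` set v \<subseteq> carrier (UT_trop n)"
    and pq: "p < n" "q < n"
    and r: "eval_word (UT_trop n) A u $$ (p, q) = Fin r"
  shows "\<exists>r'\<ge>r. eval_word (UT_trop n) A v $$ (p, q) = Fin r'"
proof (rule ccontr)
  assume no: "\<not> ?thesis"
  obtain t w k lu where occ: "occurrence w u k lu" and t: "t 0 = p" "t k = q"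
    and mono: "\<And>i. i < k \<Longrightarrow> t i < t (Suc i)"
    and fin: "\<And>x i. (x, i) \<in> set lu \<Longrightarrow> A x $$ (t i, t i) \<noteq> MInfty"
      "\<And>i. i < k \<Longrightarrow> A (w i) $$ (t i, t (Suc i)) \<noteq> MInfty"
    and wt: "r = path_weight A t w k lu"
    using entry_FinE[OF A(1) pq r] by metis
  \<comment> \<open>Strictly increasing states below \<open>n\<close> leave room for
    \<open>k + 1\<close> levels, so the separating words need no letter beyond
    \<open>n\<close>.\<close>
  have "i \<le> t i" if "i \<le> k" for i
    using that mono by (induction i) (auto intro: le_less_trans simp: Suc_le_eq)
  then have kn: "k < n" using t(2) pq(2) by (meson le_less_trans order_refl)
  have "t i \<le> t k" if "i \<le> k" for i
    using that mono by (induction rule: inc_induct) (auto intro: order_trans less_imp_le)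
  then have tn: "t i < n" if "i \<le> k" for i using that t(2) pq(2) by (metis le_less_trans)
  define D where "D = (\<lambda>(x, i). A x $$ (t i, t i))"
  \<comment> \<open>The moves weigh the same for \<open>u\<close> and \<open>v\<close>, so the
    comparison of paths reduces to their loops.\<close>
  have less: "(\<Sum>y\<leftarrow>ls. finite_part (D y)) < (\<Sum>y\<leftarrow>lu. finite_part (D y))"
    if ls: "ls \<in> {ls. occurrence w v k ls}" and finite_ls: "\<forall>y\<in>set ls. D y \<noteq> MInfty" for ls
  proof -
    have "\<exists>r'\<ge>path_weight A t w k ls. eval_word (UT_trop n) A v $$ (t 0, t k) = Fin r'"
      using ls finite_ls fin(2) tn A(2) by (intro path_weight_le_entry) (auto simp: D_def)
    with no t have "path_weight A t w k ls < path_weight A t w k lu"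
      unfolding wt by (meson le_less_trans not_le order_trans)
    then show ?thesis by (simp add: path_weight_def D_def split_def)
  qed
  have "\<forall>y\<in>set lu. D y \<noteq> MInfty" using fin(1) by (auto simp: D_def)
  from integer_weights[OF finite_occurrences this less] obtain d :: "'a \<times> nat \<Rightarrow> int"
    where d: "\<And>ls. ls \<in> {ls. occurrence w v k ls} \<Longrightarrow> (\<Sum>y\<leftarrow>ls. d y) < (\<Sum>y\<leftarrow>lu. d y)"
    by metis
  obtain \<psi> where "\<And>x. \<psi> x \<in> lists {1..n}"
    "act_word n (\<lambda>_. 0) (concat (map \<psi> u)) \<noteq> act_word n (\<lambda>_. 0) (concat (map \<psi> v))"
    by (rule grammic_separation[OF len kn occ, where d = "\<lambda>x i. d (x, i)"]) (use d in auto)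
  with eq show False by blast
qed

section \<open>The grammic action as tropical matrix multiplication\<close>

definition letter_mat :: "nat \<Rightarrow> nat \<Rightarrow> trop mat" where
  "letter_mat n a =
     mat n n (\<lambda>(i, j). if i \<le> j then Fin (if i < a \<and> a \<le> Suc j then 1 else 0) else MInfty)"

definition row_mat :: "nat \<Rightarrow> (nat \<Rightarrow> nat) \<Rightarrow> trop mat" where
  "row_mat n F = mat 1 n (\<lambda>(i, j). Fin (real (F (Suc j))))"

lemma letter_mat_closed: "letter_mat n a \<in> carrier (UT_trop n)"
  by (auto simp: letter_mat_def carrier_UT_trop zero_trop_def)

text \<open>Index \<open>i\<close> stands for the prefix sum at \<open>Suc i\<close>. In a column
  \<open>j\<close> with \<open>a \<le> Suc j\<close>, monotonicity makes the terms with
  \<open>i < a\<close> largest at \<open>i = a - 1\<close> and the later ones at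
  \<open>i = j\<close>: the two arguments of the maximum in \<open>lift\<close>.\<close>

lemma row_mat_lift:
  assumes F: "mono F" and a: "a \<in> {1..n}"
  shows "row_mat n F * letter_mat n a = row_mat n (lift F a)"
proof (rule eq_matI)
  fix i j assume "i < dim_row (row_mat n (lift F a))" "j < dim_col (row_mat n (lift F a))"
  then have i: "i = 0" and j: "j < n" by (auto simp: row_mat_def)
  define f where "f s = Fin (real (F (Suc s))) * letter_mat n a $$ (s, j)" for s
  have f: "f s = (if s \<le> j then Fin (real (F (Suc s) + (if s < a \<and> a \<le> Suc j then 1 else 0))) else MInfty)"
    if "s < n" for s
    using that j by (simp add: f_def letter_mat_def)
  have "sum f {..<n} = Fin (real (lift F a (Suc j)))"
  proof (rule sum_trop_eqI)
    \<comment> \<open>The row attaining the maximum: \<open>a - 1\<close> if the letter raises the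
      prefix sum at \<open>Suc j\<close>, else \<open>j\<close>.\<close>
    show "(if a \<le> Suc j \<and> F (Suc j) \<le> F a then a - 1 else j) \<in> {..<n}"
      using a j by auto
    show "f (if a \<le> Suc j \<and> F (Suc j) \<le> F a then a - 1 else j) = Fin (real (lift F a (Suc j)))"
    proof (cases "a \<le> Suc j \<and> F (Suc j) \<le> F a")
      case True
      then show ?thesis using a j by (subst f) (auto simp: lift_def)
    next
      case False
      then show ?thesis
        using a j by (subst f) (auto simp: lift_def not_le Suc_le_eq less_Suc_eq_le le_less)
    qed
  next
    fix s y assume s: "s \<in> {..<n}" "f s = Fin y"
    then show "y \<le> real (lift F a (Suc j))"
      using f[of s] monoD[OF F, of "Suc s" a] monoD[OF F, of "Suc s" "Suc j"]
      by (auto simp: lift_def split: if_splits)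
  qed simp
  then show "(row_mat n F * letter_mat n a) $$ (i, j) = row_mat n (lift F a) $$ (i, j)"
    using i j by (simp add: row_mat_def letter_mat_def scalar_prod_def f_def lessThan_atLeast0)
qed (simp_all add: row_mat_def letter_mat_def)

lemma row_mat_word:
  assumes "mono F" "u \<in> lists {1..n}"
  shows "row_mat n F * eval_word (UT_trop n) (letter_mat n) u = row_mat n (foldl lift F u)"
  using assms
proof (induction u arbitrary: F)
  case Nil
  have "row_mat n F \<in> carrier_mat 1 n" by (simp add: row_mat_def)
  then show ?case by (simp add: one_UT_trop)
next
  case (Cons a u)
  have "carrier (UT_trop n) \<subseteq> carrier_mat n n" by (auto simp: carrier_UT_trop)
  then have car: "row_mat n F \<in> carrier_mat 1 n" "letter_mat n a \<in> carrier_mat n n"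
    "eval_word (UT_trop n) (letter_mat n) u \<in> carrier_mat n n"
    using eval_word_closed[OF monoid_UT_trop, of "letter_mat n" u n] letter_mat_closed
    by (auto simp: row_mat_def)
  have "row_mat n F * eval_word (UT_trop n) (letter_mat n) (a # u) =
      (row_mat n F * letter_mat n a) * eval_word (UT_trop n) (letter_mat n) u"
    by (simp add: mult_UT_trop assoc_mult_mat[OF car])
  also have "\<dots> = row_mat n (lift F a) * eval_word (UT_trop n) (letter_mat n) u"
    using Cons.prems by (simp add: row_mat_lift)
  also have "\<dots> = row_mat n (foldl lift (lift F a) u)"
    using Cons.prems by (intro Cons.IH mono_lift) auto
  finally show ?case by simp
qed

lemma satisfies_identity_iff:
  assumes n: "n \<ge> 1" and uv: "(u, v) \<in> carrier (free_sgrp \<Sigma>) \<times> carrier (free_sgrp \<Sigma>)"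
  shows "satisfies_identity \<Sigma> (sgrp_of_monoid (grammic_monoid n)) (u, v) \<longleftrightarrow>
         satisfies_identity \<Sigma> (sgrp_of_monoid (UT_trop n)) (u, v)"
  unfolding satisfies_identity_grammic_iff[OF uv] satisfies_identity_monoid_iff[OF monoid_UT_trop uv]
proof (intro iffI allI impI ballI)
  fix A assume G: "\<forall>\<phi>. \<phi> ` \<Sigma> \<subseteq> lists {1..n} \<longrightarrow> (\<forall>\<gamma>\<in>nat_vecs n.
      act_word n \<gamma> (concat (map \<phi> u)) = act_word n \<gamma> (concat (map \<phi> v)))"
    and A: "A ` \<Sigma> \<subseteq> carrier (UT_trop n)"
  have eq: "act_word n (\<lambda>_. 0) (concat (map \<phi> u)) = act_word n (\<lambda>_. 0) (concat (map \<phi> v))"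
    if "\<And>x. \<phi> x \<in> lists {1..n}" for \<phi>
  proof -
    have "\<phi> ` \<Sigma> \<subseteq> lists {1..n}" using that by blast
    moreover have "(\<lambda>_. 0) \<in> nat_vecs n" by (simp add: nat_vecs_def)
    ultimately show ?thesis using G by blast
  qed
  have len: "length u = length v" by (rule grammic_identity_length[OF n eq])
  have Auv: "A ` set u \<subseteq> carrier (UT_trop n)" "A ` set v \<subseteq> carrier (UT_trop n)"
    using A uv by (auto simp: free_sgrp_def)
  have "eval_word (UT_trop n) A u \<in> carrier_mat n n" "eval_word (UT_trop n) A v \<in> carrier_mat n n"
    using Auv[THEN eval_word_closed[OF monoid_UT_trop]] by (auto simp: carrier_UT_trop)
  then show "eval_word (UT_trop n) A u = eval_word (UT_trop n) A v"
  proof (intro eq_matI; clarsimp)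
    fix p q assume pq: "p < n" "q < n"
    \<comment> \<open>Both inequalities concern finite entries; together they also force
      \<open>MInfty\<close> to occur in the same places.\<close>
    have le: "\<exists>r'\<ge>r. eval_word (UT_trop n) A v $$ (p, q) = Fin r'"
      if "eval_word (UT_trop n) A u $$ (p, q) = Fin r" for r
      by (rule UT_entry_le_of_grammic[OF eq len Auv pq that])
    have ge: "\<exists>r'\<ge>r. eval_word (UT_trop n) A u $$ (p, q) = Fin r'"
      if "eval_word (UT_trop n) A v $$ (p, q) = Fin r" for r
      by (rule UT_entry_le_of_grammic[OF eq[symmetric] len[symmetric] Auv(2,1) pq that])
    show "eval_word (UT_trop n) A u $$ (p, q) = eval_word (UT_trop n) A v $$ (p, q)"
      using le ge
      by (cases "eval_word (UT_trop n) A u $$ (p, q)"; cases "eval_word (UT_trop n) A v $$ (p, q)")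
        force+
  qed
next
  fix \<phi> \<gamma> assume T: "\<forall>f. f ` \<Sigma> \<subseteq> carrier (UT_trop n) \<longrightarrow>
      eval_word (UT_trop n) f u = eval_word (UT_trop n) f v"
    and \<phi>: "\<phi> ` \<Sigma> \<subseteq> lists {1..n}" and \<gamma>: "\<gamma> \<in> nat_vecs n"
  \<comment> \<open>Assigning the matrix \<open>E (\<phi> x)\<close> to \<open>x\<close> turns the
    identity of matrices into one between products of letter matrices; multiplying rows of prefix
    sums by these recovers the action.\<close>
  define E where "E = eval_word (UT_trop n) (letter_mat n)"
  have E: "E z \<in> carrier (UT_trop n)" for z
    unfolding E_def using letter_mat_closed by (intro eval_word_closed monoid_UT_trop) auto
  have E_concat: "eval_word (UT_trop n) (\<lambda>x. E (\<phi> x)) z = E (concat (map \<phi> z))" for z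
    using letter_mat_closed
    by (induction z) (auto simp: E_def eval_word_append[OF monoid_UT_trop] image_subset_iff)
  have "E (concat (map \<phi> u)) = E (concat (map \<phi> v))"
    using T[rule_format, of "\<lambda>x. E (\<phi> x)"] E by (simp add: E_concat image_subset_iff)
  then have rows: "row_mat n (prefix_sum \<gamma>) * E (concat (map \<phi> u)) =
      row_mat n (prefix_sum \<gamma>) * E (concat (map \<phi> v))" by simp
  have word: "concat (map \<phi> z) \<in> lists {1..n}" if "z \<in> lists \<Sigma>" for z
    using that \<phi> by (induction z) auto
  have row: "row_mat n (prefix_sum \<gamma>) * E (concat (map \<phi> z)) =
      row_mat n (prefix_sum (act_word n \<gamma> (concat (map \<phi> z))))" if "z \<in> lists \<Sigma>" for z
    unfolding E_def prefix_sum_act_word[OF \<gamma> word[OF that]]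
    by (rule row_mat_word[OF mono_prefix_sum word[OF that]])
  have uv': "u \<in> lists \<Sigma>" "v \<in> lists \<Sigma>" using uv by (auto simp: free_sgrp_def)
  show "act_word n \<gamma> (concat (map \<phi> u)) = act_word n \<gamma> (concat (map \<phi> v))"
  proof (rule nat_vecs_eqI)
    fix q assume q: "q < n"
    have "row_mat n (prefix_sum (act_word n \<gamma> (concat (map \<phi> u)))) =
        row_mat n (prefix_sum (act_word n \<gamma> (concat (map \<phi> v))))"
      using rows row uv' by metis
    from arg_cong[OF this, of "\<lambda>M. M $$ (0, q)"] q
    show "prefix_sum (act_word n \<gamma> (concat (map \<phi> u))) (Suc q) =
        prefix_sum (act_word n \<gamma> (concat (map \<phi> v))) (Suc q)"
      by (simp add: row_mat_def)
  qed (intro act_word_closed \<gamma> word uv')+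
qed

lemma identities_eq:
  assumes "n \<ge> 1"
  shows "identities \<Sigma> (sgrp_of_monoid (grammic_monoid n)) =
         identities \<Sigma> (sgrp_of_monoid (UT_trop n))"
  unfolding identities_def using satisfies_identity_iff[OF assms] by auto

theorem corollary4p1:
  fixes n :: nat and \<Sigma> :: "'x set"
  assumes "n \<ge> 1"
  shows "identities \<Sigma> (sgrp_of_monoid (grammic_monoid n)) =
         identities \<Sigma> (sgrp_of_monoid (UT_trop n)) \<and>
         (variety_generated_by (sgrp_of_monoid (grammic_monoid n)) :: 'b sgrp set) =
         variety_generated_by (sgrp_of_monoid (UT_trop n))"
  \<comment> \<open>A variety depends on its generator only through the identities, which agree over
    every alphabet.\<close>
  unfolding variety_generated_by_def identities_eq[OF assms] by simp

end
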